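(* Let $u,w\in\mathcal{D}(E)$ and suppose that $T=M_wEM_u$, $Tf=wE(uf)$, is a bounded operator on $L^2(\Sigma)$. Then: (a) If $M_wEM_u$ is centered, then $|E(uw)|^2=E(|u|^2)E(|w|^2)$ on $S(E(uw)E(w)E(u))$. (b) If $|E(uw)|^2=E(|u|^2)E(|w|^2)$, then $M_wEM_u$ is centered.
   Context: $(X,\Sigma,\mu)$ is a complete $\sigma$-finite measure space and $\mathcal{A}\subseteq\Sigma$ is a sub-$\sigma$-algebra such that $(X,\mathcal{A},\mu|_{\mathcal{A}})$ is $\sigma$-finite. $L^2(\Sigma)=L^2(X,\Sigma,\mu)$ (complex-valued functions). $L^0(\Sigma)$ is the space of a.e. classes of a.e. finite-valued $\Sigma$-measurable functions, and $L^0(\mathcal{A})$ is its analogue for $\mathcal{A}$. $E=E^{\mathcal{A}}$ is the conditional expectation with respect to $\mathcal{A}$: $E(f)$ is the unique $\mathcal{A}$-measurable function with $\int_A f\,d\mu=\int_A E(f)\,d\mu$ for $A\in\mathcal{A}$, for non-negative measurable $f$ and for $f\in L^2(\Sigma)$, and it extends in the usual way to $\mathcal{D}(E)=\{g\in L^0(\Sigma): E(|g|)\in L^0(\mathcal{A})\}$. $M_u$ denotes multiplication by $u$. The support of a measurable function $f$ is $S(f)=\{x\in X: f(x)\neq 0\}$. All equalities between functions or sets hold up to $\mu$-null sets. A bounded operator $A$ on a Hilbert space is centered if the family $\{A^{*n}A^n,\ A^kA^{*k}: n,k\ge 0\}$ is commutative. *)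

theory Defs
  imports "HOL-Probability.Probability"
begin

text \<open>
  A sub-sigma-algebra is given, as in \<open>sigma_finite_subalgebra\<close>, by a measure \<open>F\<close> of which
  only the space and the measurable sets matter.
\<close>

definition cond_exp_domain :: "'a measure \<Rightarrow> 'a measure \<Rightarrow> ('a \<Rightarrow> complex) set" where
  "cond_exp_domain M F =
    {g \<in> borel_measurable M. AE x in M. nn_cond_exp M F (\<lambda>y. ennreal (cmod (g y))) x < \<infinity>}"

text \<open>
  \<open>real_cond_exp\<close> is the difference of the extended conditional expectations of the
  positive and the negative part, so it is not restricted to integrable functions and gives the
  conditional expectation on the whole of \<open>cond_exp_domain M F\<close>.
\<close>

definition complex_cond_exp :: "'a measure \<Rightarrow> 'a measure \<Rightarrow> ('a \<Rightarrow> complex) \<Rightarrow> 'a \<Rightarrow> complex" where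
  "complex_cond_exp M F f x =
    Complex (real_cond_exp M F (\<lambda>y. Re (f y)) x) (real_cond_exp M F (\<lambda>y. Im (f y)) x)"

text \<open>
  If this is a bounded operator on \<open>L\<^sup>2\<close>, then \<open>E(\<bar>u\<bar>\<^sup>2)\<close> is finite almost everywhere on the set where
  \<open>E(\<bar>w\<bar>) > 0\<close>. So for \<open>f\<close> in \<open>L\<^sup>2\<close> the function \<open>u f\<close> is conditionable there, and the
  values that the total function \<open>complex_cond_exp\<close> takes elsewhere are multiplied by \<open>w = 0\<close>.
\<close>

definition weighted_cond_exp ::
    "'a measure \<Rightarrow> 'a measure \<Rightarrow> ('a \<Rightarrow> complex) \<Rightarrow> ('a \<Rightarrow> complex) \<Rightarrow> ('a \<Rightarrow> complex) \<Rightarrow> 'a \<Rightarrow> complex"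
  where
  "weighted_cond_exp M F w u f = (\<lambda>x. w x * complex_cond_exp M F (\<lambda>y. u y * f y) x)"

text \<open>
  Elements of \<open>L\<^sup>2\<close> are represented by square-integrable functions, equality in \<open>L\<^sup>2\<close> being
  equality almost everywhere. Operators act on representatives.
\<close>

definition L2_space :: "'a measure \<Rightarrow> ('a \<Rightarrow> complex) set" where
  "L2_space M = {f \<in> borel_measurable M. integrable M (\<lambda>x. (cmod (f x))\<^sup>2)}"

definition L2_inner :: "'a measure \<Rightarrow> ('a \<Rightarrow> complex) \<Rightarrow> ('a \<Rightarrow> complex) \<Rightarrow> complex" where
  "L2_inner M f g = (LINT x|M. f x * cnj (g x))"

definition L2_norm :: "'a measure \<Rightarrow> ('a \<Rightarrow> complex) \<Rightarrow> real" where
  "L2_norm M f = sqrt (LINT x|M. (cmod (f x))\<^sup>2)"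

text \<open>
  Linearity and the norm bound make \<open>T\<close> compatible with equality almost everywhere, so that
  \<open>T\<close> is a bounded operator on the space of classes.
\<close>

definition L2_bounded_operator :: "'a measure \<Rightarrow> (('a \<Rightarrow> complex) \<Rightarrow> 'a \<Rightarrow> complex) \<Rightarrow> bool" where
  "L2_bounded_operator M T \<longleftrightarrow>
    (\<forall>f\<in>L2_space M. T f \<in> L2_space M) \<and>
    (\<forall>f\<in>L2_space M. \<forall>g\<in>L2_space M. AE x in M. T (\<lambda>y. f y + g y) x = T f x + T g x) \<and>
    (\<forall>c. \<forall>f\<in>L2_space M. AE x in M. T (\<lambda>y. c * f y) x = c * T f x) \<and>
    (\<exists>C. \<forall>f\<in>L2_space M. L2_norm M (T f) \<le> C * L2_norm M f)"

text \<open>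
  For bounded \<open>T\<close> the adjoint exists by the Riesz representation theorem, and it is unique up to
  equality almost everywhere.
\<close>

definition L2_adjoint ::
    "'a measure \<Rightarrow> (('a \<Rightarrow> complex) \<Rightarrow> 'a \<Rightarrow> complex) \<Rightarrow> ('a \<Rightarrow> complex) \<Rightarrow> 'a \<Rightarrow> complex" where
  "L2_adjoint M T = (SOME S. (\<forall>g\<in>L2_space M. S g \<in> L2_space M) \<and>
    (\<forall>f\<in>L2_space M. \<forall>g\<in>L2_space M. L2_inner M (T f) g = L2_inner M f (S g)))"

definition centered_family ::
    "'a measure \<Rightarrow> (('a \<Rightarrow> complex) \<Rightarrow> 'a \<Rightarrow> complex) \<Rightarrow> (('a \<Rightarrow> complex) \<Rightarrow> 'a \<Rightarrow> complex) set" where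
  "centered_family M T =
    {(L2_adjoint M T ^^ n) \<circ> (T ^^ n) | n. True} \<union> {(T ^^ k) \<circ> (L2_adjoint M T ^^ k) | k. True}"

definition L2_centered :: "'a measure \<Rightarrow> (('a \<Rightarrow> complex) \<Rightarrow> 'a \<Rightarrow> complex) \<Rightarrow> bool" where
  "L2_centered M T \<longleftrightarrow> L2_bounded_operator M T \<and>
    (\<forall>A\<in>centered_family M T. \<forall>B\<in>centered_family M T. \<forall>f\<in>L2_space M.
      AE x in M. A (B f) x = B (A f) x)"

end

theory Submission imports Defs begin

text \<open>
  Write \<open>a = E(\<bar>u\<bar>\<^sup>2)\<close>, \<open>b = E(\<bar>w\<bar>\<^sup>2)\<close> and \<open>\<gamma> = E(u w)\<close>. All operators that occur have the form
  \<open>f \<mapsto> h p E(q f)\<close> with \<open>h\<close> measurable for the subalgebra. Over the ring of such \<open>h\<close> they behave like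
  operators of rank one: by the pull-out property of conditional expectation, composing
  \<open>h p E(q \<cdot>)\<close> with \<open>h' p' E(q' \<cdot>)\<close> gives \<open>h h' E(q p') p E(q' \<cdot>)\<close> (\<open>cond_rank_one_compose\<close>). Here
  \<open>T = w E(u \<cdot>)\<close>, the adjoint is \<open>S = cnj u E(cnj w \<cdot>)\<close>, and so \<open>S\<^sup>n T\<^sup>n\<close> is a multiple of
  \<open>cnj u E(u \<cdot>)\<close> and \<open>T\<^sup>k S\<^sup>k\<close> a multiple of \<open>w E(cnj w \<cdot>)\<close>. Operators of the same kind commute, and
  everything depends on the mixed products, which are multiples of \<open>\<gamma> cnj u E(cnj w \<cdot>)\<close> and of
  \<open>cnj \<gamma> w E(u \<cdot>)\<close>, with the same factor.

  If \<open>\<bar>\<gamma>\<bar>\<^sup>2 = a b\<close>, then equality holds in the conditional Cauchy-Schwarz inequality, so that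
  \<open>a w = \<gamma> cnj u\<close>, and the two mixed products agree (\<open>centered_if_equality\<close>). Conversely, let
  \<open>S T\<close> and \<open>T S\<close> commute. Both products applied to \<open>f = k w\<close>, with \<open>k > 0\<close> chosen such that \<open>f\<close> is square
  integrable, then multiplied by \<open>u\<close> and conditioned, give, up to the common factor \<open>k\<close>,
  \<open>(a b)\<^sup>2 \<gamma> = a b \<bar>\<gamma>\<bar>\<^sup>2 \<gamma>\<close>. Where \<open>\<gamma> \<noteq> 0\<close>, also
  \<open>a b \<noteq> 0\<close> by Cauchy-Schwarz, hence \<open>a b = \<bar>\<gamma>\<bar>\<^sup>2\<close> (\<open>equality_if_centered\<close>).

  This calculation requires \<open>a\<close> and \<open>b\<close> to be finite, which \<open>u\<close> and \<open>w\<close> need not satisfy. But boundedness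
  of \<open>T\<close> forces \<open>a b \<le> C\<^sup>2\<close> almost everywhere (\<open>product_of_moments_bounded\<close>), so that where one of
  the two is infinite the other one vanishes, and with it \<open>u\<close> or \<open>w\<close>. Therefore neither \<open>T\<close> nor \<open>\<gamma>\<close>
  changes when \<open>u\<close> and \<open>w\<close> are replaced by \<open>0\<close> off the set where \<open>a\<close> and \<open>b\<close> are both finite.
\<close>

section \<open>Conditional expectation of nonnegative functions\<close>

context sigma_finite_subalgebra
begin

lemma measurable_of_subalg: "f \<in> borel_measurable F \<Longrightarrow> f \<in> borel_measurable M"
  by (rule measurable_from_subalg[OF subalg])

lemma nn_cond_exp_finite_mono:
  assumes "AE x in M. nn_cond_exp M F g x < \<infinity>" "AE x in M. f x \<le> g x"
    and "f \<in> borel_measurable M" "g \<in> borel_measurable M"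
  shows "AE x in M. nn_cond_exp M F f x < \<infinity>"
  using nn_cond_exp_mono[OF assms(2-4)] assms(1) by eventually_elim (rule le_less_trans)

lemma nn_cond_exp_finite_add:
  assumes "AE x in M. nn_cond_exp M F f x < \<infinity>" "AE x in M. nn_cond_exp M F g x < \<infinity>"
    and "f \<in> borel_measurable M" "g \<in> borel_measurable M"
  shows "AE x in M. nn_cond_exp M F (\<lambda>y. f y + g y) x < \<infinity>"
  using nn_cond_exp_sum[OF assms(3,4)] assms(1,2)
  by eventually_elim (metis ennreal_add_less_top infinity_ennreal_def)

lemma nn_cond_exp_finite_mult:
  assumes "AE x in M. nn_cond_exp M F g x < \<infinity>" "AE x in M. h x < \<infinity>"
    and "h \<in> borel_measurable F" "g \<in> borel_measurable M"
  shows "AE x in M. nn_cond_exp M F (\<lambda>y. h y * g y) x < \<infinity>"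
  using nn_cond_exp_prod[OF assms(3,4)] assms(1,2)
  by eventually_elim (metis ennreal_mult_less_top infinity_ennreal_def)

lemma nn_cond_exp_finite_if_integral_finite:
  assumes [measurable]: "f \<in> borel_measurable M" and "(\<integral>\<^sup>+x. f x \<partial>M) < \<infinity>"
  shows "AE x in M. nn_cond_exp M F f x < \<infinity>"
proof -
  have "(\<integral>\<^sup>+x. nn_cond_exp M F f x \<partial>M) = (\<integral>\<^sup>+x. f x \<partial>M)"
    using nn_cond_exp_intg[of "\<lambda>_. 1" f] by simp
  then have "(\<integral>\<^sup>+x. nn_cond_exp M F f x \<partial>M) \<noteq> \<infinity>" using assms(2) by simp
  then show ?thesis using nn_integral_PInf_AE[of "nn_cond_exp M F f" M]
    by (auto simp: less_top)
qed

text \<open>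
  The set where \<open>E(f) = 0\<close> belongs to the subalgebra, and \<open>f\<close> has the same integral over it as \<open>E(f)\<close>.
\<close>

lemma eq_0_where_nn_cond_exp_eq_0:
  assumes [measurable]: "f \<in> borel_measurable M"
  shows "AE x in M. nn_cond_exp M F f x = 0 \<longrightarrow> f x = 0"
proof -
  define z where "z = (\<lambda>x. if nn_cond_exp M F f x = 0 then 1 else 0 :: ennreal)"
  have zF [measurable]: "z \<in> borel_measurable F" unfolding z_def by measurable
  have [measurable]: "z \<in> borel_measurable M" by (rule measurable_of_subalg[OF zF])
  have "(\<integral>\<^sup>+x. z x * f x \<partial>M) = (\<integral>\<^sup>+x. z x * nn_cond_exp M F f x \<partial>M)"
    by (rule nn_cond_exp_intg[symmetric]) auto
  also have "\<dots> = 0" by (auto simp: z_def intro!: nn_integral_zero')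
  finally have "AE x in M. z x * f x = 0" by (subst (asm) nn_integral_0_iff_AE) auto
  then show ?thesis by eventually_elim (auto simp: z_def)
qed

text \<open>
  Monotone convergence on both sides of \<open>\<integral>\<^sub>A f\<^sub>n = \<integral>\<^sub>A E(f\<^sub>n)\<close> shows that the supremum of the \<open>E(f\<^sub>n)\<close> has the
  property that characterizes \<open>E(sup f\<^sub>n)\<close>.
\<close>

lemma nn_cond_exp_monotone_convergence:
  assumes [measurable]: "\<And>n. f n \<in> borel_measurable M" and inc: "\<And>x. incseq (\<lambda>n. f n x)"
  shows "AE x in M. nn_cond_exp M F (\<lambda>y. SUP n. f n y) x = (SUP n. nn_cond_exp M F (f n) x)"
proof -
  have "AE x in M. (SUP n. nn_cond_exp M F (f n) x) = nn_cond_exp M F (\<lambda>y. SUP n. f n y) x"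
  proof (rule nn_cond_exp_charact)
    fix A assume A: "A \<in> sets F"
    have AM [measurable]: "A \<in> sets M" using A subalg by (auto simp: subalgebra_def)
    have "(\<integral>\<^sup>+x\<in>A. (SUP n. f n x) \<partial>M) = (\<integral>\<^sup>+x. (SUP n. indicator A x * f n x) \<partial>M)"
      by (simp add: SUP_mult_left_ennreal mult.commute)
    also have "\<dots> = (SUP n. \<integral>\<^sup>+x. indicator A x * f n x \<partial>M)"
      using inc by (intro nn_integral_monotone_convergence_SUP)
        (auto simp: incseq_def le_fun_def intro!: mult_left_mono)
    also have "\<dots> = (SUP n. \<integral>\<^sup>+x. indicator A x * nn_cond_exp M F (f n) x \<partial>M)"
      using A by (simp add: nn_cond_exp_intg)
    also have "\<dots> = (\<integral>\<^sup>+x. (SUP n. indicator A x * nn_cond_exp M F (f n) x) \<partial>M)"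
    proof (rule nn_integral_monotone_convergence_SUP_AE[symmetric])
      fix n
      have "AE x in M. nn_cond_exp M F (f n) x \<le> nn_cond_exp M F (f (Suc n)) x"
        using inc by (intro nn_cond_exp_mono) (auto simp: incseq_def)
      then show "AE x in M. indicator A x * nn_cond_exp M F (f n) x
          \<le> indicator A x * nn_cond_exp M F (f (Suc n)) x"
        by eventually_elim (auto intro!: mult_left_mono)
    qed measurable
    also have "\<dots> = (\<integral>\<^sup>+x\<in>A. (SUP n. nn_cond_exp M F (f n) x) \<partial>M)"
      by (simp add: SUP_mult_left_ennreal mult.commute)
    finally show "(\<integral>\<^sup>+x\<in>A. (SUP n. f n x) \<partial>M)
        = (\<integral>\<^sup>+x\<in>A. (SUP n. nn_cond_exp M F (f n) x) \<partial>M)" .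
  qed measurable
  then show ?thesis by eventually_elim simp
qed

section \<open>Conditional expectation of real functions\<close>

text \<open>
  For functions that are merely conditionable, integrals over sets of the subalgebra may not exist,
  and the characterization by integrals is not available. Instead,
  \<open>(f + g)\<^sup>+ + f\<^sup>- + g\<^sup>- = (f + g)\<^sup>- + f\<^sup>+ + g\<^sup>+\<close> is conditioned and the six terms, all finite, are rearranged.
\<close>

lemma real_cond_exp_add_conditionable:
  assumes [measurable]: "f \<in> borel_measurable M" "g \<in> borel_measurable M"
    and f: "AE x in M. nn_cond_exp M F (\<lambda>y. ennreal \<bar>f y\<bar>) x < \<infinity>"
    and g: "AE x in M. nn_cond_exp M F (\<lambda>y. ennreal \<bar>g y\<bar>) x < \<infinity>"
  shows "AE x in M. real_cond_exp M F (\<lambda>y. f y + g y) x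
    = real_cond_exp M F f x + real_cond_exp M F g x"
proof -
  let ?N = "\<lambda>h. nn_cond_exp M F (\<lambda>y. ennreal (h y))"
  have fin: "AE x in M. ?N h x < \<infinity>" if "AE x in M. ?N k x < \<infinity>" "\<And>x. h x \<le> k x"
      "h \<in> borel_measurable M" "k \<in> borel_measurable M" for h k
    using that by (intro nn_cond_exp_finite_mono[OF that(1)]) (auto intro: ennreal_leI)
  have fg: "AE x in M. ?N (\<lambda>y. \<bar>f y\<bar> + \<bar>g y\<bar>) x < \<infinity>"
    using nn_cond_exp_finite_add[OF f g] by (simp flip: ennreal_plus)
  have finite: "AE x in M. ?N f x < \<infinity>" "AE x in M. ?N (\<lambda>y. - f y) x < \<infinity>"
    "AE x in M. ?N g x < \<infinity>" "AE x in M. ?N (\<lambda>y. - g y) x < \<infinity>"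
    "AE x in M. ?N (\<lambda>y. f y + g y) x < \<infinity>" "AE x in M. ?N (\<lambda>y. - (f y + g y)) x < \<infinity>"
    by (rule fin[OF f] fin[OF g] fin[OF fg]; force)+
  have "(\<lambda>y. (ennreal (f y + g y) + ennreal (- f y)) + ennreal (- g y))
      = (\<lambda>y. (ennreal (- (f y + g y)) + ennreal (f y)) + ennreal (g y))"
  proof
    fix y
    show "(ennreal (f y + g y) + ennreal (- f y)) + ennreal (- g y)
      = (ennreal (- (f y + g y)) + ennreal (f y)) + ennreal (g y)"
      by (cases "f y \<ge> 0"; cases "g y \<ge> 0"; cases "f y + g y \<ge> 0")
        (auto simp: ennreal_neg simp flip: ennreal_plus)
  qed
  then have eq: "nn_cond_exp M F (\<lambda>y. (ennreal (f y + g y) + ennreal (- f y)) + ennreal (- g y))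
      = nn_cond_exp M F (\<lambda>y. (ennreal (- (f y + g y)) + ennreal (f y)) + ennreal (g y))"
    by simp
  have s1: "AE x in M. ?N (\<lambda>y. f y + g y) x + ?N (\<lambda>y. - f y) x
      = nn_cond_exp M F (\<lambda>y. ennreal (f y + g y) + ennreal (- f y)) x"
    by (rule nn_cond_exp_sum) auto
  have s2: "AE x in M. nn_cond_exp M F (\<lambda>y. ennreal (f y + g y) + ennreal (- f y)) x
      + ?N (\<lambda>y. - g y) x
      = nn_cond_exp M F (\<lambda>y. (ennreal (f y + g y) + ennreal (- f y)) + ennreal (- g y)) x"
    by (rule nn_cond_exp_sum) auto
  have s3: "AE x in M. ?N (\<lambda>y. - (f y + g y)) x + ?N f x
      = nn_cond_exp M F (\<lambda>y. ennreal (- (f y + g y)) + ennreal (f y)) x"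
    by (rule nn_cond_exp_sum) auto
  have s4: "AE x in M. nn_cond_exp M F (\<lambda>y. ennreal (- (f y + g y)) + ennreal (f y)) x
      + ?N g x
      = nn_cond_exp M F (\<lambda>y. (ennreal (- (f y + g y)) + ennreal (f y)) + ennreal (g y)) x"
    by (rule nn_cond_exp_sum) auto
  show ?thesis
    using s1 s2 s3 s4 finite
  proof eventually_elim
    case (elim x)
    have "enn2real (?N (\<lambda>y. f y + g y) x + ?N (\<lambda>y. - f y) x + ?N (\<lambda>y. - g y) x)
        = enn2real (?N (\<lambda>y. - (f y + g y)) x + ?N f x + ?N g x)"
      using elim(1-4) eq by simp
    then show ?case
      using elim(5-10) unfolding real_cond_exp_def
      by (simp add: enn2real_plus ennreal_add_less_top)
  qed
qed

text \<open>
  The positive and negative parts of \<open>h g\<close> are \<open>h\<^sup>+ g\<^sup>+ + h\<^sup>- g\<^sup>-\<close> and \<open>h\<^sup>+ g\<^sup>- + h\<^sup>- g\<^sup>+\<close>, so the pull-out property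
  follows from the one for nonnegative functions.
\<close>

lemma real_cond_exp_mult_conditionable:
  assumes hF [measurable]: "h \<in> borel_measurable F" and [measurable]: "g \<in> borel_measurable M"
    and g: "AE x in M. nn_cond_exp M F (\<lambda>y. ennreal \<bar>g y\<bar>) x < \<infinity>"
  shows "AE x in M. real_cond_exp M F (\<lambda>y. h y * g y) x = h x * real_cond_exp M F g x"
proof -
  have [measurable]: "h \<in> borel_measurable M" by (rule measurable_of_subalg[OF hF])
  let ?N = "\<lambda>h. nn_cond_exp M F (\<lambda>y. ennreal (h y))"
  have finite: "AE x in M. ?N g x < \<infinity>" "AE x in M. ?N (\<lambda>y. - g y) x < \<infinity>"
    by (rule nn_cond_exp_finite_mono[OF g]; auto intro!: AE_I2 ennreal_leI)+
  have split: "ennreal (a * b) = ennreal a * ennreal b + ennreal (- a) * ennreal (- b)" for a b :: real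
    by (cases "a \<ge> 0"; cases "b \<ge> 0")
      (auto simp: ennreal_neg mult_nonneg_nonpos mult_nonpos_nonneg mult_nonpos_nonpos simp flip: ennreal_mult)
  have nn: "AE x in M. ?N (\<lambda>y. k y * l y) x
      = ennreal (k x) * ?N l x + ennreal (- k x) * ?N (\<lambda>y. - l y) x"
    if [measurable]: "k \<in> borel_measurable F" "l \<in> borel_measurable M" for k l
  proof -
    have [measurable]: "k \<in> borel_measurable M" by (rule measurable_of_subalg[OF that(1)])
    have a: "AE x in M. ennreal (k x) * ?N l x = nn_cond_exp M F (\<lambda>y. ennreal (k y) * ennreal (l y)) x"
      by (rule nn_cond_exp_prod) auto
    have b: "AE x in M. ennreal (- k x) * ?N (\<lambda>y. - l y) x
        = nn_cond_exp M F (\<lambda>y. ennreal (- k y) * ennreal (- l y)) x"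
      by (rule nn_cond_exp_prod) auto
    have c: "AE x in M. nn_cond_exp M F (\<lambda>y. ennreal (k y) * ennreal (l y)) x
        + nn_cond_exp M F (\<lambda>y. ennreal (- k y) * ennreal (- l y)) x
        = nn_cond_exp M F (\<lambda>y. ennreal (k y) * ennreal (l y) + ennreal (- k y) * ennreal (- l y)) x"
      by (rule nn_cond_exp_sum) auto
    show ?thesis using a b c by eventually_elim (simp add: split)
  qed
  have p: "AE x in M. ?N (\<lambda>y. h y * g y) x
      = ennreal (h x) * ?N g x + ennreal (- h x) * ?N (\<lambda>y. - g y) x"
    by (rule nn) auto
  have m: "AE x in M. ?N (\<lambda>y. - (h y * g y)) x
      = ennreal (h x) * ?N (\<lambda>y. - g y) x + ennreal (- h x) * ?N g x"
    using nn[of h "\<lambda>y. - g y"] by simp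
  show ?thesis
    using p m finite
  proof eventually_elim
    case (elim x)
    have "enn2real (ennreal (h x) * ?N k x) = max 0 (h x) * enn2real (?N k x)" for k
      by (cases "h x \<ge> 0") (auto simp: enn2real_mult ennreal_neg)
    moreover have "enn2real (ennreal (- h x) * ?N k x) = max 0 (- h x) * enn2real (?N k x)" for k
      by (cases "h x \<ge> 0") (auto simp: enn2real_mult ennreal_neg)
    ultimately show ?case
      using elim unfolding real_cond_exp_def
      by (cases "h x \<ge> 0") (simp_all add: enn2real_plus ennreal_mult_less_top algebra_simps)
  qed
qed

text \<open>
  An indicator multiplies the positive and the negative part separately, so localization holds for
  every measurable function. It gets applied to products \<open>u f\<close> that may fail to be conditionable.
\<close>

lemma real_cond_exp_indicator_mult:
  assumes [measurable]: "A \<in> sets F" "g \<in> borel_measurable M"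
  shows "AE x in M. real_cond_exp M F (\<lambda>y. indicator A y * g y) x = indicator A x * real_cond_exp M F g x"
proof -
  have p: "AE x in M. indicator A x * nn_cond_exp M F (\<lambda>y. ennreal (g y)) x
      = nn_cond_exp M F (\<lambda>y. indicator A y * ennreal (g y)) x"
    by (rule nn_cond_exp_prod) auto
  have m: "AE x in M. indicator A x * nn_cond_exp M F (\<lambda>y. ennreal (- g y)) x
      = nn_cond_exp M F (\<lambda>y. indicator A y * ennreal (- g y)) x"
    by (rule nn_cond_exp_prod) auto
  have eq: "(\<lambda>y. indicator A y * ennreal (k y)) = (\<lambda>y. ennreal (indicator A y * k y))" for k :: "'a \<Rightarrow> real"
    by (auto simp: indicator_def)
  show ?thesis
    using p m unfolding eq
    by eventually_elim (auto simp: real_cond_exp_def indicator_def)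
qed

end


section \<open>Conditional expectation of complex functions\<close>

lemma cond_exp_domain_measurable [measurable_dest]:
  "f \<in> cond_exp_domain M F \<Longrightarrow> f \<in> borel_measurable M"
  by (simp add: cond_exp_domain_def)

lemma complex_cond_exp_cnj: "complex_cond_exp M F (\<lambda>y. cnj (f y)) x = cnj (complex_cond_exp M F f x)"
  by (simp add: complex_cond_exp_def real_cond_exp_def complex_eq_iff)

lemma Re_complex_cond_exp [simp]: "Re (complex_cond_exp M F f x) = real_cond_exp M F (\<lambda>y. Re (f y)) x"
  and Im_complex_cond_exp [simp]: "Im (complex_cond_exp M F f x) = real_cond_exp M F (\<lambda>y. Im (f y)) x"
  by (simp_all add: complex_cond_exp_def)

lemma borel_measurable_complex_cond_exp [measurable]:
  "complex_cond_exp M F f \<in> borel_measurable F"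
  "complex_cond_exp M F f \<in> borel_measurable M"
  unfolding borel_measurable_complex_iff by simp_all

context sigma_finite_subalgebra
begin

lemma cond_exp_domain_mult:
  assumes [measurable]: "h \<in> borel_measurable F" and g: "g \<in> cond_exp_domain M F"
  shows "(\<lambda>y. h y * g y) \<in> cond_exp_domain M F"
proof -
  have [measurable]: "g \<in> borel_measurable M" using g by measurable
  have [measurable]: "h \<in> borel_measurable M" by (rule measurable_of_subalg) fact
  have "AE x in M. nn_cond_exp M F (\<lambda>y. ennreal (cmod (h y)) * ennreal (cmod (g y))) x < \<infinity>"
    using g by (intro nn_cond_exp_finite_mult) (auto simp: cond_exp_domain_def)
  then show ?thesis by (simp add: cond_exp_domain_def norm_mult ennreal_mult)
qed

lemma cond_exp_domain_Re_Im:
  assumes g: "g \<in> cond_exp_domain M F"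
  shows "AE x in M. nn_cond_exp M F (\<lambda>y. ennreal \<bar>Re (g y)\<bar>) x < \<infinity>"
    "AE x in M. nn_cond_exp M F (\<lambda>y. ennreal \<bar>Im (g y)\<bar>) x < \<infinity>"
proof -
  have [measurable]: "g \<in> borel_measurable M" using g by measurable
  have fin: "AE x in M. nn_cond_exp M F (\<lambda>y. ennreal (cmod (g y))) x < \<infinity>"
    using g by (simp add: cond_exp_domain_def)
  show "AE x in M. nn_cond_exp M F (\<lambda>y. ennreal \<bar>Re (g y)\<bar>) x < \<infinity>"
    by (rule nn_cond_exp_finite_mono[OF fin]) (auto intro: ennreal_leI abs_Re_le_cmod)
  show "AE x in M. nn_cond_exp M F (\<lambda>y. ennreal \<bar>Im (g y)\<bar>) x < \<infinity>"
    by (rule nn_cond_exp_finite_mono[OF fin]) (auto intro: ennreal_leI abs_Im_le_cmod)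
qed

lemma complex_cond_exp_cong:
  assumes "AE x in M. f x = g x" and [measurable]: "f \<in> borel_measurable M" "g \<in> borel_measurable M"
  shows "AE x in M. complex_cond_exp M F f x = complex_cond_exp M F g x"
proof -
  have "AE x in M. real_cond_exp M F (\<lambda>y. Re (f y)) x = real_cond_exp M F (\<lambda>y. Re (g y)) x"
    "AE x in M. real_cond_exp M F (\<lambda>y. Im (f y)) x = real_cond_exp M F (\<lambda>y. Im (g y)) x"
    by (rule real_cond_exp_cong; use assms(1) in auto)+
  then show ?thesis by eventually_elim (simp add: complex_cond_exp_def)
qed

lemma complex_cond_exp_add:
  assumes f: "f \<in> cond_exp_domain M F" and g: "g \<in> cond_exp_domain M F"
  shows "AE x in M. complex_cond_exp M F (\<lambda>y. f y + g y) x
    = complex_cond_exp M F f x + complex_cond_exp M F g x"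
proof -
  have [measurable]: "f \<in> borel_measurable M" "g \<in> borel_measurable M" using f g by measurable
  have re: "AE x in M. real_cond_exp M F (\<lambda>y. Re (f y) + Re (g y)) x
      = real_cond_exp M F (\<lambda>y. Re (f y)) x + real_cond_exp M F (\<lambda>y. Re (g y)) x"
    using cond_exp_domain_Re_Im[OF f] cond_exp_domain_Re_Im[OF g]
    by (intro real_cond_exp_add_conditionable) auto
  have im: "AE x in M. real_cond_exp M F (\<lambda>y. Im (f y) + Im (g y)) x
      = real_cond_exp M F (\<lambda>y. Im (f y)) x + real_cond_exp M F (\<lambda>y. Im (g y)) x"
    using cond_exp_domain_Re_Im[OF f] cond_exp_domain_Re_Im[OF g]
    by (intro real_cond_exp_add_conditionable) auto
  show ?thesis using re im by eventually_elim (simp add: complex_eq_iff)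
qed

lemma complex_cond_exp_mult:
  assumes [measurable]: "h \<in> borel_measurable F" and g: "g \<in> cond_exp_domain M F"
  shows "AE x in M. complex_cond_exp M F (\<lambda>y. h y * g y) x = h x * complex_cond_exp M F g x"
proof -
  have [measurable]: "g \<in> borel_measurable M" using g by measurable
  have [measurable]: "h \<in> borel_measurable M" by (rule measurable_of_subalg) fact
  have pull: "AE x in M. real_cond_exp M F (\<lambda>y. k y * l y) x = k x * real_cond_exp M F l x"
    "AE x in M. nn_cond_exp M F (\<lambda>y. ennreal \<bar>k y * l y\<bar>) x < \<infinity>"
    if [measurable]: "k \<in> borel_measurable F" "l \<in> borel_measurable M"
      and l: "AE x in M. nn_cond_exp M F (\<lambda>y. ennreal \<bar>l y\<bar>) x < \<infinity>" for k l :: "'a \<Rightarrow> real"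
  proof -
    show "AE x in M. real_cond_exp M F (\<lambda>y. k y * l y) x = k x * real_cond_exp M F l x"
      by (rule real_cond_exp_mult_conditionable) (use l in auto)
    have "AE x in M. nn_cond_exp M F (\<lambda>y. ennreal \<bar>k y\<bar> * ennreal \<bar>l y\<bar>) x < \<infinity>"
      using l by (intro nn_cond_exp_finite_mult) auto
    then show "AE x in M. nn_cond_exp M F (\<lambda>y. ennreal \<bar>k y * l y\<bar>) x < \<infinity>"
      by (simp add: abs_mult ennreal_mult)
  qed
  note re = cond_exp_domain_Re_Im(1)[OF g] and im = cond_exp_domain_Re_Im(2)[OF g]
  have mRe [measurable]: "(\<lambda>y. Re (h y)) \<in> borel_measurable F" "(\<lambda>y. - Im (h y)) \<in> borel_measurable F"
    "(\<lambda>y. Im (h y)) \<in> borel_measurable F" by measurable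
  have mg [measurable]: "(\<lambda>y. Re (g y)) \<in> borel_measurable M" "(\<lambda>y. Im (g y)) \<in> borel_measurable M"
    by measurable
  have a1: "AE x in M. real_cond_exp M F (\<lambda>y. Re (h y) * Re (g y) + (- Im (h y)) * Im (g y)) x
      = real_cond_exp M F (\<lambda>y. Re (h y) * Re (g y)) x + real_cond_exp M F (\<lambda>y. (- Im (h y)) * Im (g y)) x"
    using pull(2)[OF mRe(1) mg(1) re] pull(2)[OF mRe(2) mg(2) im]
    by (intro real_cond_exp_add_conditionable) auto
  have a2: "AE x in M. real_cond_exp M F (\<lambda>y. Re (h y) * Im (g y) + Im (h y) * Re (g y)) x
      = real_cond_exp M F (\<lambda>y. Re (h y) * Im (g y)) x + real_cond_exp M F (\<lambda>y. Im (h y) * Re (g y)) x"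
    using pull(2)[OF mRe(1) mg(2) im] pull(2)[OF mRe(3) mg(1) re]
    by (intro real_cond_exp_add_conditionable) auto
  show ?thesis
    using a1 a2 pull(1)[OF mRe(1) mg(1) re] pull(1)[OF mRe(2) mg(2) im]
      pull(1)[OF mRe(1) mg(2) im] pull(1)[OF mRe(3) mg(1) re]
    by eventually_elim (simp add: complex_eq_iff algebra_simps)
qed

lemma complex_cond_exp_linear:
  assumes h: "h \<in> borel_measurable F" "k \<in> borel_measurable F"
    and f: "f \<in> cond_exp_domain M F" and g: "g \<in> cond_exp_domain M F"
  shows "AE x in M. complex_cond_exp M F (\<lambda>y. h y * f y + k y * g y) x
    = h x * complex_cond_exp M F f x + k x * complex_cond_exp M F g x"
  using complex_cond_exp_add[OF cond_exp_domain_mult[OF h(1) f] cond_exp_domain_mult[OF h(2) g]]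
    complex_cond_exp_mult[OF h(1) f] complex_cond_exp_mult[OF h(2) g]
  by eventually_elim simp

lemma complex_cond_exp_indicator_mult:
  assumes [measurable]: "A \<in> sets F" "g \<in> borel_measurable M"
  shows "AE x in M. complex_cond_exp M F (\<lambda>y. indicator A y * g y) x
    = indicator A x * complex_cond_exp M F g x"
proof -
  have re: "AE x in M. real_cond_exp M F (\<lambda>y. indicator A y * Re (g y)) x
      = indicator A x * real_cond_exp M F (\<lambda>y. Re (g y)) x"
    and im: "AE x in M. real_cond_exp M F (\<lambda>y. indicator A y * Im (g y)) x
      = indicator A x * real_cond_exp M F (\<lambda>y. Im (g y)) x"
    by (rule real_cond_exp_indicator_mult; measurable)+
  have eq: "(\<lambda>y. Re (indicator A y * g y)) = (\<lambda>y. indicator A y * Re (g y))"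
    "(\<lambda>y. Im (indicator A y * g y)) = (\<lambda>y. indicator A y * Im (g y))"
    by (auto simp: indicator_def)
  show ?thesis using re im
    by eventually_elim (auto simp add: complex_cond_exp_def complex_eq_iff eq simp del: times_complex.sel split: split_indicator)
qed

lemma complex_cond_exp_of_nonneg:
  assumes [measurable]: "f \<in> borel_measurable M" and "\<And>x. f x \<ge> 0"
  shows "AE x in M. complex_cond_exp M F (\<lambda>y. of_real (f y)) x
    = of_real (enn2real (nn_cond_exp M F (\<lambda>y. ennreal (f y)) x))"
proof -
  have "AE x in M. 0 = nn_cond_exp M F (\<lambda>_. 0) x" by (rule nn_cond_exp_F_meas) simp
  then show ?thesis
    by eventually_elim (simp add: complex_eq_iff real_cond_exp_def ennreal_neg assms(2))
qed

lemma integral_complex_cond_exp: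
  assumes f: "integrable M f"
  shows "(LINT x|M. complex_cond_exp M F f x) = (LINT x|M. f x)"
proof -
  have int: "integrable M (\<lambda>y. Re (f y))" "integrable M (\<lambda>y. Im (f y))" using f by auto
  have "complex_cond_exp M F f = (\<lambda>x. of_real (real_cond_exp M F (\<lambda>y. Re (f y)) x)
      + \<i> * of_real (real_cond_exp M F (\<lambda>y. Im (f y)) x))"
    by (simp add: fun_eq_iff complex_eq_iff)
  then have Ef: "integrable M (complex_cond_exp M F f)"
    using real_cond_exp_int(1)[OF int(1)] real_cond_exp_int(1)[OF int(2)] by simp
  show ?thesis
    using real_cond_exp_int(2)[OF int(1)] real_cond_exp_int(2)[OF int(2)] Ef f
    by (simp add: complex_eq_iff flip: integral_Re integral_Im)
qed

end


section \<open>Conditionally square-integrable functions\<close>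

lemma borel_measurable_cnj [measurable (raw)]:
  "f \<in> borel_measurable M \<Longrightarrow> (\<lambda>x. cnj (f x)) \<in> borel_measurable M"
  unfolding borel_measurable_complex_iff by simp

definition cond_L2 :: "'a measure \<Rightarrow> 'a measure \<Rightarrow> ('a \<Rightarrow> complex) set" where
  "cond_L2 M F =
    {f \<in> borel_measurable M. AE x in M. nn_cond_exp M F (\<lambda>y. ennreal ((cmod (f y))\<^sup>2)) x < \<infinity>}"

text \<open>
  The values are meaningful on \<open>cond_L2\<close>; there the conversion to a real number loses nothing
  (\<open>ennreal_cond_sq\<close>).
\<close>

definition cond_sq :: "'a measure \<Rightarrow> 'a measure \<Rightarrow> ('a \<Rightarrow> complex) \<Rightarrow> 'a \<Rightarrow> real" where
  "cond_sq M F f x = enn2real (nn_cond_exp M F (\<lambda>y. ennreal ((cmod (f y))\<^sup>2)) x)"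

lemma borel_measurable_cond_sq [measurable]:
  "cond_sq M F f \<in> borel_measurable F" "cond_sq M F f \<in> borel_measurable M"
  unfolding cond_sq_def by measurable

lemma cond_sq_nonneg [simp]: "cond_sq M F f x \<ge> 0"
  by (simp add: cond_sq_def)

lemma cond_sq_cnj [simp]: "cond_sq M F (\<lambda>y. cnj (f y)) = cond_sq M F f"
  by (simp add: cond_sq_def fun_eq_iff)

lemma cond_L2_measurable [measurable_dest]: "f \<in> cond_L2 M F \<Longrightarrow> f \<in> borel_measurable M"
  by (simp add: cond_L2_def)

lemma cond_L2_cnj: "f \<in> cond_L2 M F \<Longrightarrow> (\<lambda>y. cnj (f y)) \<in> cond_L2 M F"
  by (auto simp: cond_L2_def)

lemma ennreal_cond_sq:
  "f \<in> cond_L2 M F \<Longrightarrow>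
    AE x in M. ennreal (cond_sq M F f x) = nn_cond_exp M F (\<lambda>y. ennreal ((cmod (f y))\<^sup>2)) x"
  unfolding cond_L2_def cond_sq_def by (auto elim!: eventually_mono)

lemma L2_space_measurable [measurable_dest]: "f \<in> L2_space M \<Longrightarrow> f \<in> borel_measurable M"
  by (simp add: L2_space_def)

lemma L2_space_iff_nn_integral:
  "f \<in> L2_space M \<longleftrightarrow> f \<in> borel_measurable M \<and> (\<integral>\<^sup>+x. ennreal ((cmod (f x))\<^sup>2) \<partial>M) < \<infinity>"
  by (auto simp: L2_space_def integrable_iff_bounded)

lemma L2_space_diff:
  assumes "f \<in> L2_space M" "g \<in> L2_space M"
  shows "(\<lambda>x. f x - g x) \<in> L2_space M"
proof -
  have [measurable]: "f \<in> borel_measurable M" "g \<in> borel_measurable M" using assms by measurable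
  have le: "(cmod (a - b))\<^sup>2 \<le> 2 * (cmod a)\<^sup>2 + 2 * (cmod b)\<^sup>2" for a b
  proof -
    have "(cmod (a - b))\<^sup>2 \<le> (cmod a + cmod b)\<^sup>2"
      by (intro power_mono norm_triangle_ineq4) auto
    also have "\<dots> \<le> 2 * (cmod a)\<^sup>2 + 2 * (cmod b)\<^sup>2"
      using sum_squares_bound[of "cmod a" "cmod b"] by (simp add: power2_sum)
    finally show ?thesis .
  qed
  have "integrable M (\<lambda>x. 2 * (cmod (f x))\<^sup>2 + 2 * (cmod (g x))\<^sup>2)"
    using assms by (simp add: L2_space_def)
  then have "integrable M (\<lambda>x. (cmod (f x - g x))\<^sup>2)"
    by (rule Bochner_Integration.integrable_bound) (auto intro!: AE_I2 le)
  then show ?thesis by (simp add: L2_space_def)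
qed

lemma L2_product_integrable:
  assumes "f \<in> L2_space M" "g \<in> L2_space M"
  shows "integrable M (\<lambda>x. f x * cnj (g x))"
proof -
  have [measurable]: "f \<in> borel_measurable M" "g \<in> borel_measurable M" using assms by measurable
  have "integrable M (\<lambda>x. (cmod (f x))\<^sup>2 + (cmod (g x))\<^sup>2)"
    using assms by (simp add: L2_space_def)
  then show ?thesis
  proof (rule Bochner_Integration.integrable_bound)
    show "AE x in M. norm (f x * cnj (g x)) \<le> norm ((cmod (f x))\<^sup>2 + (cmod (g x))\<^sup>2)"
    proof (rule AE_I2)
      fix x
      have "0 \<le> cmod (f x) * cmod (g x)" by simp
      then have "cmod (f x) * cmod (g x) \<le> (cmod (f x))\<^sup>2 + (cmod (g x))\<^sup>2"
        using sum_squares_bound[of "cmod (f x)" "cmod (g x)"] by linarith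
      then show "norm (f x * cnj (g x)) \<le> norm ((cmod (f x))\<^sup>2 + (cmod (g x))\<^sup>2)"
        by (simp add: norm_mult)
    qed
  qed measurable
qed

context sigma_finite_subalgebra
begin

lemma L2_space_subset_cond_L2: "f \<in> L2_space M \<Longrightarrow> f \<in> cond_L2 M F"
  using nn_cond_exp_finite_if_integral_finite[of "\<lambda>y. ennreal ((cmod (f y))\<^sup>2)"]
  unfolding L2_space_iff_nn_integral cond_L2_def by auto

lemma cond_L2_product:
  assumes f: "f \<in> cond_L2 M F" and g: "g \<in> cond_L2 M F"
  shows "(\<lambda>y. f y * g y) \<in> cond_exp_domain M F"
proof -
  have [measurable]: "f \<in> borel_measurable M" "g \<in> borel_measurable M" using f g by measurable
  have "AE x in M. nn_cond_exp M F (\<lambda>y. ennreal ((cmod (f y))\<^sup>2) + ennreal ((cmod (g y))\<^sup>2)) x < \<infinity>"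
    using f g by (intro nn_cond_exp_finite_add) (auto simp: cond_L2_def)
  moreover have "ennreal (cmod (f x * g x)) \<le> ennreal ((cmod (f x))\<^sup>2) + ennreal ((cmod (g x))\<^sup>2)" for x
  proof -
    have "0 \<le> cmod (f x) * cmod (g x)" by simp
    then have "cmod (f x * g x) \<le> (cmod (f x))\<^sup>2 + (cmod (g x))\<^sup>2"
      using sum_squares_bound[of "cmod (f x)" "cmod (g x)"] unfolding norm_mult by linarith
    then show ?thesis by (simp add: ennreal_leI flip: ennreal_plus)
  qed
  ultimately have "AE x in M. nn_cond_exp M F (\<lambda>y. ennreal (cmod (f y * g y))) x < \<infinity>"
    by (rule nn_cond_exp_finite_mono[OF _ AE_I2]) measurable
  then show ?thesis by (simp add: cond_exp_domain_def)
qed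

lemma complex_cond_exp_abs_square:
  assumes [measurable]: "f \<in> borel_measurable M"
  shows "AE x in M. complex_cond_exp M F (\<lambda>y. f y * cnj (f y)) x = of_real (cond_sq M F f x)"
  using complex_cond_exp_of_nonneg[of "\<lambda>y. (cmod (f y))\<^sup>2"]
  by (simp add: cond_sq_def complex_norm_square[symmetric])

lemma cond_L2_linear:
  assumes h [measurable]: "h \<in> borel_measurable F" and k [measurable]: "k \<in> borel_measurable F"
    and f: "f \<in> cond_L2 M F" and g: "g \<in> cond_L2 M F"
  shows "(\<lambda>y. h y * f y + k y * g y) \<in> cond_L2 M F"
proof -
  have [measurable]: "f \<in> borel_measurable M" "g \<in> borel_measurable M" using f g by measurable
  have [measurable]: "h \<in> borel_measurable M" "k \<in> borel_measurable M"
    using h k by (auto intro: measurable_of_subalg)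
  have *: "AE x in M. nn_cond_exp M F (\<lambda>y. ennreal (2 * (cmod (l y))\<^sup>2) * ennreal ((cmod (p y))\<^sup>2)) x < \<infinity>"
    if "p \<in> cond_L2 M F" and [measurable]: "l \<in> borel_measurable F" for l p
    using that by (intro nn_cond_exp_finite_mult) (auto simp: cond_L2_def)
  have "AE x in M. nn_cond_exp M F (\<lambda>y. ennreal (2 * (cmod (h y))\<^sup>2) * ennreal ((cmod (f y))\<^sup>2)
      + ennreal (2 * (cmod (k y))\<^sup>2) * ennreal ((cmod (g y))\<^sup>2)) x < \<infinity>"
    using *[OF f h] *[OF g k] by (intro nn_cond_exp_finite_add) auto
  moreover have "ennreal ((cmod (h x * f x + k x * g x))\<^sup>2)
      \<le> ennreal (2 * (cmod (h x))\<^sup>2) * ennreal ((cmod (f x))\<^sup>2)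
        + ennreal (2 * (cmod (k x))\<^sup>2) * ennreal ((cmod (g x))\<^sup>2)" for x
  proof -
    have "(cmod (h x * f x + k x * g x))\<^sup>2 \<le> (cmod (h x * f x) + cmod (k x * g x))\<^sup>2"
      by (intro power_mono norm_triangle_ineq) auto
    also have "\<dots> \<le> 2 * (cmod (h x * f x))\<^sup>2 + 2 * (cmod (k x * g x))\<^sup>2"
      using sum_squares_bound[of "cmod (h x * f x)" "cmod (k x * g x)"] by (simp add: power2_sum)
    finally have "(cmod (h x * f x + k x * g x))\<^sup>2
        \<le> 2 * (cmod (h x))\<^sup>2 * (cmod (f x))\<^sup>2 + 2 * (cmod (k x))\<^sup>2 * (cmod (g x))\<^sup>2"
      by (simp add: norm_mult power_mult_distrib mult.assoc)
    then show ?thesis by (simp add: ennreal_leI flip: ennreal_plus ennreal_mult)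
  qed
  ultimately have "AE x in M. nn_cond_exp M F (\<lambda>y. ennreal ((cmod (h y * f y + k y * g y))\<^sup>2)) x < \<infinity>"
    by (rule nn_cond_exp_finite_mono[OF _ AE_I2]) measurable
  then show ?thesis by (simp add: cond_L2_def)
qed

lemma eq_0_where_cond_sq_eq_0:
  assumes f: "f \<in> cond_L2 M F"
  shows "AE x in M. cond_sq M F f x = 0 \<longrightarrow> f x = 0"
proof -
  have [measurable]: "f \<in> borel_measurable M" using f by measurable
  have "AE x in M. nn_cond_exp M F (\<lambda>y. ennreal ((cmod (f y))\<^sup>2)) x = 0 \<longrightarrow> ennreal ((cmod (f x))\<^sup>2) = 0"
    by (rule eq_0_where_nn_cond_exp_eq_0) measurable
  then show ?thesis using ennreal_cond_sq[OF f]
    by eventually_elim (auto simp: ennreal_eq_0_iff)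
qed

text \<open>
  With \<open>\<beta> = E(\<bar>g\<bar>\<^sup>2)\<close>, the function \<open>\<beta> f - \<gamma> cnj g\<close> is \<open>\<beta>\<close> times the component of \<open>f\<close> that is conditionally orthogonal to
  \<open>cnj g\<close>. Multiplying by \<open>\<beta>\<close> avoids a division by zero. The formula for its conditional square
  gives both the conditional Cauchy-Schwarz inequality and its case of equality.
\<close>

lemma cond_sq_residual:
  assumes f: "f \<in> cond_L2 M F" and g: "g \<in> cond_L2 M F"
  defines "\<gamma> \<equiv> complex_cond_exp M F (\<lambda>y. f y * g y)"
  shows "AE x in M. cond_sq M F (\<lambda>y. of_real (cond_sq M F g y) * f y - \<gamma> y * cnj (g y)) x
    = cond_sq M F g x * (cond_sq M F f x * cond_sq M F g x - (cmod (\<gamma> x))\<^sup>2)"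
proof -
  define \<beta> where "\<beta> = (\<lambda>y. complex_of_real (cond_sq M F g y))"
  \<comment> \<open>Written as a sum, to match linearity; the vanishing of \<open>E(cnj g \<cdot> cnj r)\<close> below is the orthogonality.\<close>
  define r where "r = (\<lambda>y. \<beta> y * f y + (- \<gamma> y) * cnj (g y))"
  have \<beta>F: "\<beta> \<in> borel_measurable F" unfolding \<beta>_def by measurable
  have \<gamma>F: "\<gamma> \<in> borel_measurable F" "(\<lambda>y. - \<gamma> y) \<in> borel_measurable F"
      "(\<lambda>y. - cnj (\<gamma> y)) \<in> borel_measurable F"
    unfolding \<gamma>_def by measurable
  have r: "r \<in> cond_L2 M F"
    unfolding r_def by (intro cond_L2_linear \<beta>F \<gamma>F f cond_L2_cnj g)
  have meas: "f \<in> borel_measurable M" "g \<in> borel_measurable M" "r \<in> borel_measurable M"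
    using f g r by measurable
  note cf = cond_L2_cnj[OF f] and cg = cond_L2_cnj[OF g] and cr = cond_L2_cnj[OF r]
  have E1: "AE x in M. complex_cond_exp M F (\<lambda>y. f y * cnj (r y)) x
      = \<beta> x * complex_cond_exp M F (\<lambda>y. f y * cnj (f y)) x - cnj (\<gamma> x) * \<gamma> x"
    using complex_cond_exp_linear[OF \<beta>F \<gamma>F(3) cond_L2_product[OF f cf] cond_L2_product[OF f g]]
    by (simp add: \<beta>_def r_def algebra_simps \<gamma>_def)
  have "complex_cond_exp M F (\<lambda>y. cnj (g y) * cnj (f y)) x = cnj (\<gamma> x)" for x
    using complex_cond_exp_cnj[of M F "\<lambda>y. f y * g y" x] by (simp add: \<gamma>_def mult.commute)
  then have E2: "AE x in M. complex_cond_exp M F (\<lambda>y. cnj (g y) * cnj (r y)) x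
      = \<beta> x * cnj (\<gamma> x) - cnj (\<gamma> x) * complex_cond_exp M F (\<lambda>y. g y * cnj (g y)) x"
    using complex_cond_exp_linear[OF \<beta>F \<gamma>F(3) cond_L2_product[OF cg cf] cond_L2_product[OF g cg]]
    by (simp add: \<beta>_def r_def algebra_simps)
  have E3: "AE x in M. complex_cond_exp M F (\<lambda>y. r y * cnj (r y)) x
      = \<beta> x * complex_cond_exp M F (\<lambda>y. f y * cnj (r y)) x
        - \<gamma> x * complex_cond_exp M F (\<lambda>y. cnj (g y) * cnj (r y)) x"
    using complex_cond_exp_linear[OF \<beta>F \<gamma>F(2) cond_L2_product[OF f cr] cond_L2_product[OF cg cr]]
    by (simp add: r_def algebra_simps)
  have "(\<lambda>y. of_real (cond_sq M F g y) * f y - \<gamma> y * cnj (g y)) = r"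
    by (simp add: r_def \<beta>_def fun_eq_iff)
  moreover have "AE x in M. cond_sq M F r x
      = cond_sq M F g x * (cond_sq M F f x * cond_sq M F g x - (cmod (\<gamma> x))\<^sup>2)"
    using E1 E2 E3 meas[THEN complex_cond_exp_abs_square]
  proof eventually_elim
    case (elim x)
    have "complex_of_real (cond_sq M F r x)
        = of_real (cond_sq M F g x) * (of_real (cond_sq M F f x) * of_real (cond_sq M F g x) - \<gamma> x * cnj (\<gamma> x))"
      using elim(3) unfolding elim(1,2,4-6) \<beta>_def by (simp add: algebra_simps)
    also have "\<gamma> x * cnj (\<gamma> x) = of_real ((cmod (\<gamma> x))\<^sup>2)" by (simp only: complex_norm_square)
    finally show ?case by (simp only: of_real_mult[symmetric] of_real_diff[symmetric] of_real_eq_iff)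
  qed
  ultimately show ?thesis by simp
qed

text \<open>
  Localized to \<open>Z\<close>, the function is almost everywhere \<open>0\<close>, however large it may be elsewhere.
\<close>

lemma complex_cond_exp_eq_0_on:
  assumes Z [measurable]: "Z \<in> sets F" and [measurable]: "g \<in> borel_measurable M"
    and 0: "AE x in M. x \<in> Z \<longrightarrow> g x = 0"
  shows "AE x in M. x \<in> Z \<longrightarrow> complex_cond_exp M F g x = 0"
proof -
  have ZM [measurable]: "Z \<in> sets M" using Z subalg by (auto simp: subalgebra_def)
  have "AE x in M. complex_cond_exp M F (\<lambda>y. indicator Z y * g y) x = complex_cond_exp M F (\<lambda>y. 0) x"
    using 0 by (intro complex_cond_exp_cong) (auto simp: indicator_def elim!: eventually_mono)
  moreover have "AE x in M. complex_cond_exp M F (\<lambda>y. 0) x = 0"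
    using complex_cond_exp_indicator_mult[of "{}" "\<lambda>_. 0"] by simp
  moreover have "AE x in M. complex_cond_exp M F (\<lambda>y. indicator Z y * g y) x
      = indicator Z x * complex_cond_exp M F g x"
    by (rule complex_cond_exp_indicator_mult) measurable
  ultimately show ?thesis by eventually_elim auto
qed

text \<open>
  Where \<open>E(\<bar>g\<bar>\<^sup>2) > 0\<close> this is nonnegativity of the conditional square in \<open>cond_sq_residual\<close>. Where
  \<open>E(\<bar>g\<bar>\<^sup>2) = 0\<close> that formula is void, but \<open>g\<close> itself vanishes there.
\<close>

lemma conditional_Cauchy_Schwarz:
  assumes f: "f \<in> cond_L2 M F" and g: "g \<in> cond_L2 M F"
  shows "AE x in M. (cmod (complex_cond_exp M F (\<lambda>y. f y * g y) x))\<^sup>2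
    \<le> cond_sq M F f x * cond_sq M F g x"
proof -
  have [measurable]: "f \<in> borel_measurable M" "g \<in> borel_measurable M" using f g by measurable
  define Z where "Z = {x \<in> space M. cond_sq M F g x = 0}"
  have "space F = space M" using subalg by (simp add: subalgebra_def)
  then have "Z = {x \<in> space F. cond_sq M F g x = 0}" by (simp add: Z_def)
  then have Z: "Z \<in> sets F" by simp
  have "AE x in M. x \<in> Z \<longrightarrow> f x * g x = 0"
    using eq_0_where_cond_sq_eq_0[OF g] by eventually_elim (simp add: Z_def)
  then have "AE x in M. x \<in> Z \<longrightarrow> complex_cond_exp M F (\<lambda>y. f y * g y) x = 0"
    by (intro complex_cond_exp_eq_0_on Z) measurable
  then show ?thesis using cond_sq_residual[OF f g] AE_space
  proof eventually_elim
    case (elim x)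
    show ?case
    proof (cases "cond_sq M F g x = 0")
      case True
      then show ?thesis using elim by (simp add: Z_def)
    next
      case False
      then have "cond_sq M F g x > 0" using cond_sq_nonneg[of M F g x] by linarith
      moreover have "0 \<le> cond_sq M F g x * (cond_sq M F f x * cond_sq M F g x
          - (cmod (complex_cond_exp M F (\<lambda>y. f y * g y) x))\<^sup>2)"
        unfolding elim(2)[symmetric] by (rule cond_sq_nonneg)
      ultimately show ?thesis by (simp add: zero_le_mult_iff)
    qed
  qed
qed

lemma conditional_Cauchy_Schwarz_equality:
  assumes f: "f \<in> cond_L2 M F" and g: "g \<in> cond_L2 M F"
    and eq: "AE x in M. (cmod (complex_cond_exp M F (\<lambda>y. f y * g y) x))\<^sup>2
      = cond_sq M F f x * cond_sq M F g x"
  shows "AE x in M. of_real (cond_sq M F g x) * f x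
    = complex_cond_exp M F (\<lambda>y. f y * g y) x * cnj (g x)"
proof -
  define \<gamma> where "\<gamma> = complex_cond_exp M F (\<lambda>y. f y * g y)"
  define r where "r = (\<lambda>y. of_real (cond_sq M F g y) * f y - \<gamma> y * cnj (g y))"
  have "(\<lambda>y. complex_of_real (cond_sq M F g y)) \<in> borel_measurable F" "(\<lambda>y. - \<gamma> y) \<in> borel_measurable F"
    unfolding \<gamma>_def by measurable
  from cond_L2_linear[OF this f cond_L2_cnj[OF g]] have r: "r \<in> cond_L2 M F"
    by (simp add: r_def)
  show ?thesis
    using cond_sq_residual[OF f g] eq eq_0_where_cond_sq_eq_0[OF r]
    unfolding \<gamma>_def[symmetric] r_def[symmetric]
    by eventually_elim (simp add: r_def)
qed

section \<open>Operators of the form \<open>f \<mapsto> p E(q f)\<close>\<close>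

lemma weighted_cond_exp_measurable:
  assumes "p \<in> borel_measurable M"
  shows "weighted_cond_exp M F p q f \<in> borel_measurable M"
  using assms unfolding weighted_cond_exp_def by measurable

text \<open>
  Here \<open>q g = (k E(q' f)) (q p')\<close>, and the first factor, which is measurable for the subalgebra, can be
  pulled out.
\<close>

lemma weighted_cond_exp_compose:
  assumes [measurable]: "k \<in> borel_measurable F" "g \<in> borel_measurable M" "q \<in> borel_measurable M"
    and D: "(\<lambda>y. q y * p' y) \<in> cond_exp_domain M F" and p' [measurable]: "p' \<in> borel_measurable M"
    and g: "AE x in M. g x = k x * weighted_cond_exp M F p' q' f x"
  shows "AE x in M. weighted_cond_exp M F p q g x
    = k x * complex_cond_exp M F (\<lambda>y. q y * p' y) x * weighted_cond_exp M F p q' f x"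
proof -
  have [measurable]: "k \<in> borel_measurable M" by (rule measurable_of_subalg) fact
  have "AE x in M. complex_cond_exp M F (\<lambda>y. q y * g y) x
      = complex_cond_exp M F (\<lambda>y. (k y * complex_cond_exp M F (\<lambda>y. q' y * f y) y) * (q y * p' y)) x"
    using g by (intro complex_cond_exp_cong) (auto simp: weighted_cond_exp_def elim!: eventually_mono)
  moreover have "AE x in M.
      complex_cond_exp M F (\<lambda>y. (k y * complex_cond_exp M F (\<lambda>y. q' y * f y) y) * (q y * p' y)) x
      = k x * complex_cond_exp M F (\<lambda>y. q' y * f y) x * complex_cond_exp M F (\<lambda>y. q y * p' y) x"
    by (rule complex_cond_exp_mult[OF _ D]) measurable
  ultimately show ?thesis by eventually_elim (simp add: weighted_cond_exp_def)
qed

text \<open>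
  By conditional Cauchy-Schwarz,
  \<open>\<integral> \<bar>p\<bar>\<^sup>2 \<bar>E(q f)\<bar>\<^sup>2 = \<integral> E(\<bar>p\<bar>\<^sup>2) \<bar>E(q f)\<bar>\<^sup>2 \<le> \<integral> E(\<bar>p\<bar>\<^sup>2) E(\<bar>q\<bar>\<^sup>2) E(\<bar>f\<bar>\<^sup>2) \<le> K \<integral> \<bar>f\<bar>\<^sup>2\<close>.
\<close>

lemma weighted_cond_exp_L2:
  assumes p: "p \<in> cond_L2 M F" and q: "q \<in> cond_L2 M F" and f: "f \<in> L2_space M"
    and K: "AE x in M. cond_sq M F p x * cond_sq M F q x \<le> K"
  shows "weighted_cond_exp M F p q f \<in> L2_space M"
proof -
  have [measurable]: "p \<in> borel_measurable M" "f \<in> borel_measurable M" using p f by measurable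
  have f': "f \<in> cond_L2 M F" by (rule L2_space_subset_cond_L2[OF f])
  let ?E = "complex_cond_exp M F (\<lambda>y. q y * f y)"
  let ?n = "\<lambda>f. nn_cond_exp M F (\<lambda>y. ennreal ((cmod (f y))\<^sup>2))"
  have "(\<integral>\<^sup>+x. ennreal ((cmod (weighted_cond_exp M F p q f x))\<^sup>2) \<partial>M)
      = (\<integral>\<^sup>+x. ennreal ((cmod (?E x))\<^sup>2) * ennreal ((cmod (p x))\<^sup>2) \<partial>M)"
    by (simp add: weighted_cond_exp_def norm_mult power_mult_distrib ennreal_mult mult.commute)
  also have "\<dots> = (\<integral>\<^sup>+x. ennreal ((cmod (?E x))\<^sup>2) * ?n p x \<partial>M)"
    by (rule nn_cond_exp_intg[symmetric]) measurable
  also have "\<dots> \<le> (\<integral>\<^sup>+x. ennreal K * ?n f x \<partial>M)"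
  proof (rule nn_integral_mono_AE)
    show "AE x in M. ennreal ((cmod (?E x))\<^sup>2) * ?n p x \<le> ennreal K * ?n f x"
      using conditional_Cauchy_Schwarz[OF q f'] K ennreal_cond_sq[OF p] ennreal_cond_sq[OF f']
    proof eventually_elim
      case (elim x)
      have "(cmod (?E x))\<^sup>2 * cond_sq M F p x \<le> (cond_sq M F q x * cond_sq M F f x) * cond_sq M F p x"
        using elim(1) by (rule mult_right_mono) simp
      also have "\<dots> = (cond_sq M F p x * cond_sq M F q x) * cond_sq M F f x" by simp
      also have "\<dots> \<le> K * cond_sq M F f x" using elim(2) by (rule mult_right_mono) simp
      finally have "(cmod (?E x))\<^sup>2 * cond_sq M F p x \<le> K * cond_sq M F f x" .
      moreover have "K \<ge> 0" using elim(2) by (rule order_trans[rotated]) simp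
      ultimately show ?case
        by (simp add: ennreal_leI elim(3,4)[symmetric] flip: ennreal_mult)
    qed
  qed
  also have "\<dots> = (\<integral>\<^sup>+x. ennreal K * ennreal ((cmod (f x))\<^sup>2) \<partial>M)"
    by (rule nn_cond_exp_intg) measurable
  also have "\<dots> = ennreal K * (\<integral>\<^sup>+x. ennreal ((cmod (f x))\<^sup>2) \<partial>M)"
    by (rule nn_integral_cmult) measurable
  also have "\<dots> < \<infinity>"
    using f by (simp add: L2_space_iff_nn_integral ennreal_mult_less_top)
  finally show ?thesis
    unfolding L2_space_iff_nn_integral using weighted_cond_exp_measurable[of p q f] by simp
qed

text \<open>
  Both integrands have the conditional expectation \<open>E(q f) E(p cnj g)\<close>.
\<close>

lemma weighted_cond_exp_adjoint:
  assumes p: "p \<in> cond_L2 M F" and q: "q \<in> cond_L2 M F"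
    and K: "AE x in M. cond_sq M F p x * cond_sq M F q x \<le> K"
    and f: "f \<in> L2_space M" and g: "g \<in> L2_space M"
  shows "L2_inner M (weighted_cond_exp M F p q f) g
    = L2_inner M f (weighted_cond_exp M F (\<lambda>y. cnj (q y)) (\<lambda>y. cnj (p y)) g)"
proof -
  let ?Ef = "complex_cond_exp M F (\<lambda>y. q y * f y)" and ?Eg = "complex_cond_exp M F (\<lambda>y. p y * cnj (g y))"
  note f' = L2_space_subset_cond_L2[OF f] and g' = cond_L2_cnj[OF L2_space_subset_cond_L2[OF g]]
  have K': "AE x in M. cond_sq M F (\<lambda>y. cnj (q y)) x * cond_sq M F (\<lambda>y. cnj (p y)) x \<le> K"
    using K by (simp add: mult.commute)
  have cnj_Eg: "cnj (complex_cond_exp M F (\<lambda>y. cnj (p y) * g y) x) = ?Eg x" for x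
    using complex_cond_exp_cnj[of M F "\<lambda>y. p y * cnj (g y)" x] by simp
  have i1: "integrable M (\<lambda>x. weighted_cond_exp M F p q f x * cnj (g x))"
    by (intro L2_product_integrable weighted_cond_exp_L2[OF p q f K] g)
  have i2: "integrable M (\<lambda>x. f x * cnj (weighted_cond_exp M F (\<lambda>y. cnj (q y)) (\<lambda>y. cnj (p y)) g x))"
    by (rule L2_product_integrable[OF f weighted_cond_exp_L2[OF cond_L2_cnj[OF q] cond_L2_cnj[OF p] g K']])
  have "L2_inner M (weighted_cond_exp M F p q f) g
      = (LINT x|M. complex_cond_exp M F (\<lambda>x. weighted_cond_exp M F p q f x * cnj (g x)) x)"
    unfolding L2_inner_def by (rule integral_complex_cond_exp[OF i1, symmetric])
  also have "\<dots> = (LINT x|M. complex_cond_exp M F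
      (\<lambda>x. f x * cnj (weighted_cond_exp M F (\<lambda>y. cnj (q y)) (\<lambda>y. cnj (p y)) g x)) x)"
  proof (rule integral_cong_AE)
    have e1: "AE x in M. complex_cond_exp M F (\<lambda>x. ?Ef x * (p x * cnj (g x))) x = ?Ef x * ?Eg x"
      by (rule complex_cond_exp_mult[OF _ cond_L2_product[OF p g']]) measurable
    have e2: "AE x in M. complex_cond_exp M F (\<lambda>x. ?Eg x * (q x * f x)) x = ?Eg x * ?Ef x"
      by (rule complex_cond_exp_mult[OF _ cond_L2_product[OF q f']]) measurable
    have eq: "(\<lambda>x. weighted_cond_exp M F p q f x * cnj (g x)) = (\<lambda>x. ?Ef x * (p x * cnj (g x)))"
      "(\<lambda>x. f x * cnj (weighted_cond_exp M F (\<lambda>y. cnj (q y)) (\<lambda>y. cnj (p y)) g x))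
        = (\<lambda>x. ?Eg x * (q x * f x))"
      by (simp_all add: weighted_cond_exp_def fun_eq_iff cnj_Eg)
    show "AE x in M. complex_cond_exp M F (\<lambda>x. weighted_cond_exp M F p q f x * cnj (g x)) x
        = complex_cond_exp M F
          (\<lambda>x. f x * cnj (weighted_cond_exp M F (\<lambda>y. cnj (q y)) (\<lambda>y. cnj (p y)) g x)) x"
      using e1 e2 unfolding eq by eventually_elim simp
  qed measurable
  also have "\<dots> = L2_inner M f (weighted_cond_exp M F (\<lambda>y. cnj (q y)) (\<lambda>y. cnj (p y)) g)"
    unfolding L2_inner_def by (rule integral_complex_cond_exp[OF i2])
  finally show ?thesis .
qed

end

text \<open>
  Two adjoints of the same operator agree almost everywhere, because the difference of their values
  at \<open>g\<close> is orthogonal to itself. So an explicit adjoint computes \<open>L2_adjoint\<close>, which is obtained by choice.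
\<close>

lemma L2_adjoint_unique:
  assumes S: "\<And>g. g \<in> L2_space M \<Longrightarrow> S g \<in> L2_space M"
    and adj: "\<And>f g. f \<in> L2_space M \<Longrightarrow> g \<in> L2_space M \<Longrightarrow> L2_inner M (T f) g = L2_inner M f (S g)"
    and g: "g \<in> L2_space M"
  shows "L2_adjoint M T g \<in> L2_space M" "AE x in M. L2_adjoint M T g x = S g x"
proof -
  define A where "A = L2_adjoint M T"
  have "(\<forall>g\<in>L2_space M. A g \<in> L2_space M) \<and>
    (\<forall>f\<in>L2_space M. \<forall>g\<in>L2_space M. L2_inner M (T f) g = L2_inner M f (A g))"
    unfolding A_def L2_adjoint_def by (rule someI[of _ S]) (use S adj in auto)
  then have A: "A g \<in> L2_space M" and A_adj: "\<And>f. f \<in> L2_space M \<Longrightarrow> L2_inner M (T f) g = L2_inner M f (A g)"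
    using g by auto
  define d where "d = (\<lambda>x. A g x - S g x)"
  have d: "d \<in> L2_space M" unfolding d_def by (intro L2_space_diff A S g)
  have [measurable]: "d \<in> borel_measurable M" using d by measurable
  have "(LINT x|M. d x * cnj (d x)) = (LINT x|M. d x * cnj (A g x) - d x * cnj (S g x))"
    by (simp add: d_def algebra_simps)
  also have "\<dots> = L2_inner M d (A g) - L2_inner M d (S g)"
    unfolding L2_inner_def by (intro Bochner_Integration.integral_diff L2_product_integrable d A S g)
  also have "\<dots> = 0" using A_adj[OF d] adj[OF d g] by simp
  also have "(\<lambda>x. d x * cnj (d x)) = (\<lambda>x. complex_of_real ((cmod (d x))\<^sup>2))"
    by (simp only: complex_norm_square)
  finally have "complex_of_real (LINT x|M. (cmod (d x))\<^sup>2) = 0"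
    by (simp only: integral_complex_of_real)
  then have "(LINT x|M. (cmod (d x))\<^sup>2) = 0" by simp
  then have "AE x in M. (cmod (d x))\<^sup>2 = 0"
    using d by (subst (asm) integral_nonneg_eq_0_iff_AE) (auto simp: L2_space_def)
  then show "AE x in M. L2_adjoint M T g x = S g x"
    by eventually_elim (simp add: d_def A_def)
  show "L2_adjoint M T g \<in> L2_space M" using A by (simp add: A_def)
qed


context sigma_finite_subalgebra
begin

text \<open>
  The factor \<open>h\<close> plays the role of a scalar. Equality is only required almost everywhere and on
  square-integrable functions, since this is all that is known of an adjoint obtained by choice.
\<close>

definition cond_rank_one ::
    "(('a \<Rightarrow> complex) \<Rightarrow> 'a \<Rightarrow> complex) \<Rightarrow> ('a \<Rightarrow> complex) \<Rightarrow> ('a \<Rightarrow> complex) \<Rightarrow> ('a \<Rightarrow> complex) \<Rightarrow> bool"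
  where
  "cond_rank_one R h p q \<longleftrightarrow> h \<in> borel_measurable F \<and> p \<in> cond_L2 M F \<and> q \<in> cond_L2 M F \<and>
    (\<forall>f\<in>L2_space M. R f \<in> L2_space M \<and> (AE x in M. R f x = h x * weighted_cond_exp M F p q f x))"

lemma cond_rank_oneD:
  assumes "cond_rank_one R h p q"
  shows "h \<in> borel_measurable F" "p \<in> cond_L2 M F" "q \<in> cond_L2 M F"
    "\<And>f. f \<in> L2_space M \<Longrightarrow> R f \<in> L2_space M"
    "\<And>f. f \<in> L2_space M \<Longrightarrow> AE x in M. R f x = h x * weighted_cond_exp M F p q f x"
  using assms by (auto simp: cond_rank_one_def)

lemma cond_rank_one_compose:
  assumes R: "cond_rank_one R h p q" and R': "cond_rank_one R' h' p' q'"
  shows "cond_rank_one (R \<circ> R') (\<lambda>x. h x * h' x * complex_cond_exp M F (\<lambda>y. q y * p' y) x) p q'"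
proof -
  note R = cond_rank_oneD[OF R] and R' = cond_rank_oneD[OF R']
  have [measurable]: "h \<in> borel_measurable F" "h' \<in> borel_measurable F" by (rule R(1) R'(1))+
  have "AE x in M. R (R' f) x
      = h x * h' x * complex_cond_exp M F (\<lambda>y. q y * p' y) x * weighted_cond_exp M F p q' f x"
    if f: "f \<in> L2_space M" for f
  proof -
    have "AE x in M. weighted_cond_exp M F p q (R' f) x
        = h' x * complex_cond_exp M F (\<lambda>y. q y * p' y) x * weighted_cond_exp M F p q' f x"
      by (rule weighted_cond_exp_compose[OF R'(1) _ _ cond_L2_product[OF R(3) R'(2)] _ R'(5)[OF f]])
        (use R(3) R'(2) R'(4)[OF f] in \<open>auto intro: cond_L2_measurable L2_space_measurable\<close>)
    with R(5)[OF R'(4)[OF f]] show ?thesis by eventually_elim simp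
  qed
  moreover have "(\<lambda>x. h x * h' x * complex_cond_exp M F (\<lambda>y. q y * p' y) x) \<in> borel_measurable F"
    by measurable
  ultimately show ?thesis
    using R(2,4) R'(3,4) by (auto simp: cond_rank_one_def)
qed

lemma cond_rank_one_funpow:
  assumes R: "cond_rank_one R (\<lambda>_. 1) p q"
  shows "cond_rank_one (R ^^ Suc n) (\<lambda>x. complex_cond_exp M F (\<lambda>y. q y * p y) x ^ n) p q"
proof (induction n)
  case 0
  then show ?case using R by simp
next
  case (Suc n)
  have "R ^^ Suc (Suc n) = R \<circ> (R ^^ Suc n)" by (rule funpow.simps(2))
  moreover have "(\<lambda>x. 1 * complex_cond_exp M F (\<lambda>y. q y * p y) x ^ n * complex_cond_exp M F (\<lambda>y. q y * p y) x)
      = (\<lambda>x. complex_cond_exp M F (\<lambda>y. q y * p y) x ^ Suc n)"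
    by (simp add: mult.commute)
  ultimately show ?case using cond_rank_one_compose[OF R Suc] by (simp only:)
qed

text \<open>
  Sigma-finiteness of the restricted measure, rather than of \<open>M\<close>, yields a function that is measurable
  for the subalgebra.
\<close>

lemma ex_positive_integrable_subalg:
  "\<exists>l :: 'a \<Rightarrow> real. l \<in> borel_measurable F \<and> (\<forall>x. 0 < l x) \<and> integrable M l"
proof -
  interpret N: sigma_finite_measure "restr_to_subalg M F" by (rule sigma_fin_subalg)
  obtain l :: "'a \<Rightarrow> real" where l: "l \<in> borel_measurable (restr_to_subalg M F)" "\<And>x. 0 < l x"
      "integrable (restr_to_subalg M F) l"
    using N.obtain_positive_integrable_function by metis
  have lF: "l \<in> borel_measurable F" by (rule measurable_in_subalg'[OF subalg l(1)])
  have lM: "integrable M l" by (rule integrable_from_subalg[OF subalg l(3)])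
  show ?thesis using lF l(2) lM by blast
qed

text \<open>
  With \<open>l\<close> positive and integrable, \<open>k\<^sup>2 = l / (1 + E(\<bar>w\<bar>\<^sup>2))\<close> gives \<open>\<integral> k\<^sup>2 \<bar>w\<bar>\<^sup>2 \<le> \<integral> l\<close>.
\<close>

lemma cond_L2_obtain_weight:
  assumes w: "w \<in> cond_L2 M F"
  obtains k :: "'a \<Rightarrow> real" where "k \<in> borel_measurable F" "\<And>x. k x > 0"
    "(\<lambda>x. of_real (k x) * w x) \<in> L2_space M"
proof -
  obtain l :: "'a \<Rightarrow> real" where lF [measurable]: "l \<in> borel_measurable F" and l: "\<And>x. 0 < l x" and lM: "integrable M l"
    using ex_positive_integrable_subalg by blast
  have [measurable]: "w \<in> borel_measurable M" using w by measurable
  define k where "k = (\<lambda>x. sqrt (l x / (1 + cond_sq M F w x)))"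
  have pos: "1 + cond_sq M F w x > 0" for x using cond_sq_nonneg[of M F w x] by linarith
  have kF [measurable]: "k \<in> borel_measurable F" unfolding k_def by measurable
  have [measurable]: "k \<in> borel_measurable M" by (rule measurable_of_subalg[OF kF])
  have k2: "(k x)\<^sup>2 = l x / (1 + cond_sq M F w x)" for x
    using l[of x] pos[of x] by (simp add: k_def)
  have "(\<integral>\<^sup>+x. ennreal ((cmod (of_real (k x) * w x))\<^sup>2) \<partial>M)
      = (\<integral>\<^sup>+x. ennreal ((k x)\<^sup>2) * ennreal ((cmod (w x))\<^sup>2) \<partial>M)"
    by (simp add: norm_mult power_mult_distrib ennreal_mult)
  also have "\<dots> = (\<integral>\<^sup>+x. ennreal ((k x)\<^sup>2) * nn_cond_exp M F (\<lambda>y. ennreal ((cmod (w y))\<^sup>2)) x \<partial>M)"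
    by (rule nn_cond_exp_intg[symmetric]) measurable
  also have "\<dots> \<le> (\<integral>\<^sup>+x. ennreal (l x) \<partial>M)"
  proof (rule nn_integral_mono_AE)
    show "AE x in M. ennreal ((k x)\<^sup>2) * nn_cond_exp M F (\<lambda>y. ennreal ((cmod (w y))\<^sup>2)) x \<le> ennreal (l x)"
      using ennreal_cond_sq[OF w]
    proof eventually_elim
      case (elim x)
      have "(k x)\<^sup>2 * cond_sq M F w x \<le> l x"
        using l[of x] pos[of x] unfolding k2 by (simp add: divide_simps algebra_simps)
      then show ?case unfolding elim[symmetric] by (simp add: ennreal_leI flip: ennreal_mult)
    qed
  qed
  also have "\<dots> < \<infinity>"
    using lM l by (simp add: integrable_iff_bounded less_imp_le)
  finally have "(\<lambda>x. of_real (k x) * w x) \<in> L2_space M"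
    by (simp add: L2_space_iff_nn_integral)
  moreover have "k x > 0" for x using l[of x] pos[of x] by (simp add: k_def)
  ultimately show ?thesis using that kF by blast
qed

end

section \<open>Centered operators\<close>

text \<open>
  The weights are conditionally square integrable here. The operator \<open>T\<close> is only assumed to agree
  almost everywhere with the one given by \<open>w\<close> and \<open>u\<close>, because it will come from other weights, from
  which \<open>w\<close> and \<open>u\<close> arise by restriction to a set.
\<close>

locale weighted_conditional_operator = sigma_finite_subalgebra M F for M F :: "'a measure" +
  fixes w u :: "'a \<Rightarrow> complex" and T :: "('a \<Rightarrow> complex) \<Rightarrow> 'a \<Rightarrow> complex" and K :: real
  assumes w: "w \<in> cond_L2 M F" and u: "u \<in> cond_L2 M F"
    and bound: "AE x in M. cond_sq M F w x * cond_sq M F u x \<le> K"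
    and T_bounded: "L2_bounded_operator M T"
    and T_eq: "\<And>f. f \<in> L2_space M \<Longrightarrow> AE x in M. T f x = weighted_cond_exp M F w u f x"
begin

abbreviation "S \<equiv> L2_adjoint M T"
abbreviation "u' \<equiv> \<lambda>y. cnj (u y)"
abbreviation "w' \<equiv> \<lambda>y. cnj (w y)"

abbreviation "\<gamma> \<equiv> complex_cond_exp M F (\<lambda>y. u y * w y)"

lemmas u' = cond_L2_cnj[OF u] and w' = cond_L2_cnj[OF w]

lemma cnj_cross: "complex_cond_exp M F (\<lambda>y. w' y * u' y) x = cnj (\<gamma> x)"
  using complex_cond_exp_cnj[of M F "\<lambda>y. u y * w y" x] by (simp add: mult.commute)

lemma T_rank_one: "cond_rank_one T (\<lambda>_. 1) w u"
  using w u T_eq T_bounded by (simp add: cond_rank_one_def L2_bounded_operator_def)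

lemma S_rank_one: "cond_rank_one S (\<lambda>_. 1) u' w'"
proof -
  have bound': "AE x in M. cond_sq M F u' x * cond_sq M F w' x \<le> K"
    using bound by (simp add: mult.commute)
  have L2: "weighted_cond_exp M F u' w' g \<in> L2_space M" if "g \<in> L2_space M" for g
    by (rule weighted_cond_exp_L2[OF u' w' that bound'])
  have "L2_inner M (T f) g = L2_inner M f (weighted_cond_exp M F u' w' g)"
    if f: "f \<in> L2_space M" and g: "g \<in> L2_space M" for f g
  proof -
    have [measurable]: "T f \<in> borel_measurable M" "g \<in> borel_measurable M"
        "weighted_cond_exp M F w u f \<in> borel_measurable M"
      using cond_rank_oneD(4)[OF T_rank_one f] g w
      by (auto intro: L2_space_measurable weighted_cond_exp_measurable cond_L2_measurable)
    have "L2_inner M (T f) g = L2_inner M (weighted_cond_exp M F w u f) g"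
      unfolding L2_inner_def using T_eq[OF f] by (intro integral_cong_AE) auto
    then show ?thesis using weighted_cond_exp_adjoint[OF w u bound f g] by simp
  qed
  note L2_adjoint_unique[of M "weighted_cond_exp M F u' w'" T, OF L2 this]
  then show ?thesis using u' w' by (simp add: cond_rank_one_def)
qed

lemma ST_rank_one:
  obtains h where "cond_rank_one ((S ^^ Suc n) \<circ> (T ^^ Suc n)) h u' u"
  using cond_rank_one_compose[OF cond_rank_one_funpow[OF S_rank_one] cond_rank_one_funpow[OF T_rank_one]]
  by blast

lemma TS_rank_one:
  obtains h where "cond_rank_one ((T ^^ Suc n) \<circ> (S ^^ Suc n)) h w w'"
  using cond_rank_one_compose[OF cond_rank_one_funpow[OF T_rank_one] cond_rank_one_funpow[OF S_rank_one]]
  by blast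

lemma centered_family_cases:
  assumes "A \<in> centered_family M T"
  obtains "A = id" | h where "cond_rank_one A h u' u" | h where "cond_rank_one A h w w'"
proof -
  from assms consider n where "A = (S ^^ n) \<circ> (T ^^ n)" | n where "A = (T ^^ n) \<circ> (S ^^ n)"
    unfolding centered_family_def by blast
  then show ?thesis
  proof cases
    case 1
    then show ?thesis using that(1,2) ST_rank_one by (cases n) (force, metis)
  next
    case 2
    then show ?thesis using that(1,3) TS_rank_one by (cases n) (force, metis)
  qed
qed

text \<open>
  Equality in Cauchy-Schwarz makes \<open>w\<close> parallel to \<open>cnj u\<close>, namely \<open>a w = \<gamma> cnj u\<close> with \<open>a = E(\<bar>u\<bar>\<^sup>2)\<close>. Then
  \<open>\<gamma> cnj u E(cnj w f)\<close> and \<open>cnj \<gamma> w E(u f)\<close> agree, since both become \<open>\<bar>\<gamma>\<bar>\<^sup>2 cnj u E(u f)\<close> when they are multiplied by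
  \<open>a\<close>, and both vanish where \<open>a = 0\<close>.
\<close>

lemma centered_if_equality:
  assumes eq: "AE x in M. (cmod (\<gamma> x))\<^sup>2 = cond_sq M F u x * cond_sq M F w x"
  shows "L2_centered M T"
proof -
  have same: "AE x in M. A (B f) x = B (A f) x"
    if A: "cond_rank_one A h p q" and B: "cond_rank_one B k p q" and f: "f \<in> L2_space M" for A B h k p q f
    using cond_rank_oneD(5)[OF cond_rank_one_compose[OF A B] f]
      cond_rank_oneD(5)[OF cond_rank_one_compose[OF B A] f]
    by eventually_elim simp
  have parallel: "AE x in M. of_real (cond_sq M F u x) * w x = \<gamma> x * cnj (u x)"
    using conditional_Cauchy_Schwarz_equality[OF w u] eq by (simp add: mult.commute)
  have swap: "AE x in M. \<gamma> x * weighted_cond_exp M F u' w' f x = cnj (\<gamma> x) * weighted_cond_exp M F w u f x"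
    if f: "f \<in> L2_space M" for f
  proof -
    have f': "f \<in> cond_L2 M F" by (rule L2_space_subset_cond_L2[OF f])
    have [measurable]: "u \<in> borel_measurable M" "w \<in> borel_measurable M" "f \<in> borel_measurable M"
      using u w f' by measurable
    have "AE x in M. of_real (cond_sq M F u x) * cnj (w x) = cnj (\<gamma> x) * u x"
      using parallel by eventually_elim (metis complex_cnj_cnj complex_cnj_complex_of_real complex_cnj_mult)
    then have "AE x in M. complex_cond_exp M F (\<lambda>y. of_real (cond_sq M F u y) * (w' y * f y)) x
        = complex_cond_exp M F (\<lambda>y. cnj (\<gamma> y) * (u y * f y)) x"
      by (intro complex_cond_exp_cong) (auto simp: mult.assoc[symmetric])
    moreover have "AE x in M. complex_cond_exp M F (\<lambda>y. of_real (cond_sq M F u y) * (w' y * f y)) x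
        = of_real (cond_sq M F u x) * complex_cond_exp M F (\<lambda>y. w' y * f y) x"
      by (rule complex_cond_exp_mult[OF _ cond_L2_product[OF w' f']]) measurable
    moreover have "AE x in M. complex_cond_exp M F (\<lambda>y. cnj (\<gamma> y) * (u y * f y)) x
        = cnj (\<gamma> x) * complex_cond_exp M F (\<lambda>y. u y * f y) x"
      by (rule complex_cond_exp_mult[OF _ cond_L2_product[OF u f']]) measurable
    ultimately show ?thesis using parallel eq
    proof eventually_elim
      case (elim x)
      define a where "a = complex_of_real (cond_sq M F u x)"
      have 1: "a * complex_cond_exp M F (\<lambda>y. w' y * f y) x = cnj (\<gamma> x) * complex_cond_exp M F (\<lambda>y. u y * f y) x"
        and 2: "a * w x = \<gamma> x * cnj (u x)" using elim(1-4) by (simp_all add: a_def)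
      show ?case
      proof (cases "a = 0")
        case True
        then have "\<gamma> x = 0" using elim(5) by (simp add: a_def)
        then show ?thesis by simp
      next
        case False
        have "a * (\<gamma> x * weighted_cond_exp M F u' w' f x)
            = \<gamma> x * cnj (u x) * (a * complex_cond_exp M F (\<lambda>y. w' y * f y) x)"
          by (simp add: weighted_cond_exp_def)
        also have "\<dots> = a * (cnj (\<gamma> x) * weighted_cond_exp M F w u f x)"
          unfolding 1 2[symmetric] by (simp add: weighted_cond_exp_def)
        finally show ?thesis using False by simp
      qed
    qed
  qed
  have cross: "AE x in M. A (B f) x = B (A f) x"
    if A: "cond_rank_one A h u' u" and B: "cond_rank_one B k w w'" and f: "f \<in> L2_space M" for A B h k f
    using cond_rank_oneD(5)[OF cond_rank_one_compose[OF A B] f]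
      cond_rank_oneD(5)[OF cond_rank_one_compose[OF B A] f] swap[OF f]
    unfolding cnj_cross by eventually_elim (simp add: ac_simps)
  have "AE x in M. A (B f) x = B (A f) x"
    if A: "A \<in> centered_family M T" and B: "B \<in> centered_family M T" and f: "f \<in> L2_space M" for A B f
    by (rule centered_family_cases[OF A]; rule centered_family_cases[OF B])
      (use f in \<open>auto intro: same cross AE_symmetric[OF cross]\<close>)
  then show ?thesis using T_bounded by (simp add: L2_centered_def)
qed

text \<open>
  Comparing \<open>S T T S\<close> with \<open>T S S T\<close> tests whether \<open>w\<close> is parallel to \<open>cnj u\<close>. The test function is \<open>k w\<close>, and the operator \<open>f \<mapsto> E(u f)\<close> is
  applied to both products in order to get an equation between functions that are measurable for
  the subalgebra.
\<close>

lemma equality_if_centered: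
  assumes "L2_centered M T"
  shows "AE x in M. \<gamma> x \<noteq> 0 \<longrightarrow> (cmod (\<gamma> x))\<^sup>2 = cond_sq M F u x * cond_sq M F w x"
proof -
  let ?E = "complex_cond_exp M F"
  have meas [measurable]: "u \<in> borel_measurable M" "w \<in> borel_measurable M" using u w by measurable
  have ST: "cond_rank_one (S \<circ> T) (?E (\<lambda>y. w' y * w y)) u' u"
    using cond_rank_one_compose[OF S_rank_one T_rank_one] by simp
  have TS: "cond_rank_one (T \<circ> S) (?E (\<lambda>y. u y * u' y)) w w'"
    using cond_rank_one_compose[OF T_rank_one S_rank_one] by simp
  obtain k :: "'a \<Rightarrow> real" where k [measurable]: "k \<in> borel_measurable F" and k_pos: "\<And>x. k x > 0"
      and kw: "(\<lambda>x. of_real (k x) * w x) \<in> L2_space M"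
    using cond_L2_obtain_weight[OF w] by metis
  define f where "f = (\<lambda>x. of_real (k x) * w x)"
  have f: "f \<in> L2_space M" using kw by (simp add: f_def)
  \<comment> \<open>The exponents are \<open>n = k = 1\<close>.\<close>
  have "(S \<circ> T) \<in> centered_family M T" "(T \<circ> S) \<in> centered_family M T"
    unfolding centered_family_def by (auto intro: exI[of _ 1])
  then have comm: "AE x in M. (S \<circ> T) ((T \<circ> S) f) x = (T \<circ> S) ((S \<circ> T) f) x"
    using assms f unfolding L2_centered_def by blast
  let ?A = "(S \<circ> T) \<circ> (T \<circ> S)" and ?B = "(T \<circ> S) \<circ> (S \<circ> T)"
  note AB = cond_rank_one_compose[OF ST TS] and BA = cond_rank_one_compose[OF TS ST]
  have [measurable]: "?A f \<in> borel_measurable M" "?B f \<in> borel_measurable M"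
    using cond_rank_oneD(4)[OF AB f] cond_rank_oneD(4)[OF BA f] by (auto intro: L2_space_measurable)
  have 1: "AE x in M. weighted_cond_exp M F (\<lambda>_. 1) u (?A f) x
      = ?E (\<lambda>y. w' y * w y) x * ?E (\<lambda>y. u y * u' y) x * \<gamma> x * ?E (\<lambda>y. u y * u' y) x
        * weighted_cond_exp M F (\<lambda>_. 1) w' f x"
    by (rule weighted_cond_exp_compose[OF cond_rank_oneD(1)[OF AB] _ _ cond_L2_product[OF u u'] _
          cond_rank_oneD(5)[OF AB f]]) measurable
  have 2: "AE x in M. weighted_cond_exp M F (\<lambda>_. 1) u (?B f) x
      = ?E (\<lambda>y. u y * u' y) x * ?E (\<lambda>y. w' y * w y) x * cnj (\<gamma> x) * \<gamma> x
        * weighted_cond_exp M F (\<lambda>_. 1) u f x"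
    unfolding cnj_cross[symmetric]
    by (rule weighted_cond_exp_compose[OF cond_rank_oneD(1)[OF BA] _ _ cond_L2_product[OF u w] _
          cond_rank_oneD(5)[OF BA f]]) measurable
  have "AE x in M. u x * ?A f x = u x * ?B f x"
    using comm by eventually_elim simp
  then have 3: "AE x in M. ?E (\<lambda>y. u y * ?A f y) x = ?E (\<lambda>y. u y * ?B f y) x"
    by (rule complex_cond_exp_cong) measurable
  have 4: "AE x in M. ?E (\<lambda>y. of_real (k y) * (w' y * w y)) x = of_real (k x) * ?E (\<lambda>y. w' y * w y) x"
    by (rule complex_cond_exp_mult[OF _ cond_L2_product[OF w' w]]) measurable
  have 5: "AE x in M. ?E (\<lambda>y. of_real (k y) * (u y * w y)) x = of_real (k x) * \<gamma> x"
    by (rule complex_cond_exp_mult[OF _ cond_L2_product[OF u w]]) measurable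
  have f_eq: "(\<lambda>y. w' y * f y) = (\<lambda>y. of_real (k y) * (w' y * w y))"
    "(\<lambda>y. u y * f y) = (\<lambda>y. of_real (k y) * (u y * w y))"
    by (simp_all add: f_def fun_eq_iff)
  have ww: "AE x in M. ?E (\<lambda>y. w' y * w y) x = of_real (cond_sq M F w x)"
    using complex_cond_exp_abs_square[OF meas(2)] by (simp add: mult.commute)
  show ?thesis
    using 1 2 3 4 5 ww complex_cond_exp_abs_square[OF meas(1)] conditional_Cauchy_Schwarz[OF u w]
  proof eventually_elim
    case (elim x)
    define a b where "a = cond_sq M F u x" and "b = cond_sq M F w x"
    have "complex_of_real (b * a) * \<gamma> x * of_real a * (of_real (k x) * of_real b)
        = of_real (a * b) * cnj (\<gamma> x) * \<gamma> x * (of_real (k x) * \<gamma> x)"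
      using elim(1-5) unfolding weighted_cond_exp_def f_eq elim(6,7) a_def b_def by simp
    then have *: "of_real (k x) * (of_real (a * b) * \<gamma> x) * complex_of_real (a * b)
        = of_real (k x) * (of_real (a * b) * \<gamma> x) * (\<gamma> x * cnj (\<gamma> x))"
      by (simp add: algebra_simps)
    show ?case
    proof
      assume nz: "\<gamma> x \<noteq> 0"
      then have "0 < (cmod (\<gamma> x))\<^sup>2" by simp
      then have "a * b \<noteq> 0" using elim(8) unfolding a_def[symmetric] b_def[symmetric] by linarith
      with nz have "of_real (k x) * (of_real (a * b) * \<gamma> x) \<noteq> 0"
        using k_pos[of x] by simp
      then have "complex_of_real (a * b) = \<gamma> x * cnj (\<gamma> x)"
        using * by (simp only: mult_cancel_left) simp
      also have "\<dots> = of_real ((cmod (\<gamma> x))\<^sup>2)" by (simp only: complex_norm_square)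
      finally show "(cmod (\<gamma> x))\<^sup>2 = cond_sq M F u x * cond_sq M F w x"
        unfolding a_def[symmetric] b_def[symmetric] of_real_eq_iff by simp
    qed
  qed
qed

end


section \<open>Boundedness of the operator\<close>

lemma nn_integral_eq_L2_norm:
  assumes "f \<in> L2_space M"
  shows "(\<integral>\<^sup>+x. ennreal ((cmod (f x))\<^sup>2) \<partial>M) = ennreal ((L2_norm M f)\<^sup>2)"
  using assms by (simp add: nn_integral_eq_integral L2_space_def L2_norm_def)

lemma SUP_truncated_square:
  "(SUP n::nat. ennreal ((cmod (if cmod z \<le> real n then z else 0))\<^sup>2)) = ennreal ((cmod z)\<^sup>2)"
proof (rule antisym)
  obtain n :: nat where "cmod z \<le> real n" using real_arch_simple by blast
  then show "ennreal ((cmod z)\<^sup>2) \<le> (SUP n::nat. ennreal ((cmod (if cmod z \<le> real n then z else 0))\<^sup>2))"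
    by (intro SUP_upper2[of n]) auto
qed (auto intro!: SUP_least)

context sigma_finite_subalgebra
begin

text \<open>
  For the truncation \<open>v\<close> of \<open>u\<close>, let \<open>a = E(\<bar>v\<bar>\<^sup>2)\<close>, which is finite, and \<open>b = E(\<bar>w\<bar>\<^sup>2)\<close>. For
  \<open>f = k cnj v\<close> with real \<open>k\<close> measurable for the subalgebra, \<open>u f = k \<bar>v\<bar>\<^sup>2\<close> and \<open>T f = w k a\<close>, so the norm bound reads
  \<open>\<integral> k\<^sup>2 a\<^sup>2 b \<le> C\<^sup>2 \<integral> k\<^sup>2 a\<close>. Taking for \<open>k\<^sup>2\<close> an integrable function that is positive exactly on
  \<open>N = {C\<^sup>2 a < a\<^sup>2 b}\<close> shows that \<open>N\<close> is a null set. Off \<open>N\<close>, one factor \<open>a\<close> cancels.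
\<close>

lemma truncated_norm_bound:
  assumes [measurable]: "u \<in> borel_measurable M" "w \<in> borel_measurable M"
    and T: "\<And>f. f \<in> L2_space M \<Longrightarrow> weighted_cond_exp M F w u f \<in> L2_space M"
    and C: "\<And>f. f \<in> L2_space M \<Longrightarrow> L2_norm M (weighted_cond_exp M F w u f) \<le> C * L2_norm M f"
  defines "v \<equiv> \<lambda>n y. if cmod (u y) \<le> real n then u y else 0"
  shows "AE x in M. nn_cond_exp M F (\<lambda>y. ennreal ((cmod (w y))\<^sup>2)) x
    * nn_cond_exp M F (\<lambda>y. ennreal ((cmod (v n y))\<^sup>2)) x \<le> ennreal (C\<^sup>2)"
proof -
  have v [measurable]: "v n \<in> borel_measurable M" unfolding v_def by measurable
  have v_le: "cmod (v n y) \<le> real n" for y by (simp add: v_def)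
  define a where "a = nn_cond_exp M F (\<lambda>y. ennreal ((cmod (v n y))\<^sup>2))"
  define b where "b = nn_cond_exp M F (\<lambda>y. ennreal ((cmod (w y))\<^sup>2))"
  have [measurable]: "a \<in> borel_measurable F" "b \<in> borel_measurable F"
    "a \<in> borel_measurable M" "b \<in> borel_measurable M" unfolding a_def b_def by measurable
  have "AE x in M. ennreal ((real n)\<^sup>2) = nn_cond_exp M F (\<lambda>_. ennreal ((real n)\<^sup>2)) x"
    by (rule nn_cond_exp_F_meas) measurable
  then have "AE x in M. nn_cond_exp M F (\<lambda>_. ennreal ((real n)\<^sup>2)) x < \<infinity>"
    by eventually_elim (metis ennreal_less_top infinity_ennreal_def)
  then have "AE x in M. nn_cond_exp M F (\<lambda>y. ennreal ((cmod (v n y))\<^sup>2)) x < \<infinity>"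
    by (rule nn_cond_exp_finite_mono) (auto intro!: ennreal_leI power_mono v_le)
  then have v_cond: "v n \<in> cond_L2 M F" by (simp add: cond_L2_def)
  have a: "AE x in M. ennreal (cond_sq M F (v n) x) = a x"
    unfolding a_def by (rule ennreal_cond_sq[OF v_cond])
  define N where "N = {x \<in> space M. ennreal (C\<^sup>2) * a x < b x * a x * a x}"
  have "space F = space M" using subalg by (simp add: subalgebra_def)
  then have "N = {x \<in> space F. ennreal (C\<^sup>2) * a x < b x * a x * a x}" by (simp add: N_def)
  then have NF [measurable]: "N \<in> sets F" by simp
  then have [measurable]: "N \<in> sets M" using subalg by (auto simp: subalgebra_def)
  obtain l :: "'a \<Rightarrow> real" where lF [measurable]: "l \<in> borel_measurable F" and l: "\<And>x. 0 < l x" and lM: "integrable M l"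
    using ex_positive_integrable_subalg by blast
  have [measurable]: "l \<in> borel_measurable M" by (rule measurable_of_subalg[OF lF])
  define k where "k = (\<lambda>x. indicator N x * sqrt (l x))"
  have kF [measurable]: "k \<in> borel_measurable F" unfolding k_def by measurable
  have [measurable]: "k \<in> borel_measurable M" by (rule measurable_of_subalg[OF kF])
  have k2: "(k x)\<^sup>2 = indicator N x * l x" for x
    using l[of x] by (simp add: k_def power_mult_distrib indicator_def)
  define f where "f = (\<lambda>x. of_real (k x) * cnj (v n x))"
  have f: "f \<in> L2_space M"
  proof -
    have "integrable M (\<lambda>x. (cmod (f x))\<^sup>2)"
    proof (rule Bochner_Integration.integrable_bound)
      show "integrable M (\<lambda>x. (real n)\<^sup>2 * l x)" using lM by simp
      have "(cmod (f x))\<^sup>2 \<le> (real n)\<^sup>2 * l x" for x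
      proof -
        have "(cmod (f x))\<^sup>2 = (cmod (v n x))\<^sup>2 * (indicator N x * l x)"
          unfolding f_def norm_mult power_mult_distrib k2[symmetric] by simp
        also have "\<dots> \<le> (real n)\<^sup>2 * l x"
          using l[of x] by (intro mult_mono power_mono v_le) (auto simp: indicator_def)
        finally show ?thesis .
      qed
      then show "AE x in M. norm ((cmod (f x))\<^sup>2) \<le> norm ((real n)\<^sup>2 * l x)"
        using l by (auto simp: abs_mult less_imp_le)
    qed (simp add: f_def)
    then show ?thesis by (simp add: L2_space_def f_def)
  qed
  have uf: "(\<lambda>y. u y * f y) = (\<lambda>y. of_real (k y) * (v n y * cnj (v n y)))"
    by (auto simp: f_def v_def fun_eq_iff)
  have "AE x in M. complex_cond_exp M F (\<lambda>y. of_real (k y) * (v n y * cnj (v n y))) x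
      = of_real (k x) * complex_cond_exp M F (\<lambda>y. v n y * cnj (v n y)) x"
    by (rule complex_cond_exp_mult[OF _ cond_L2_product[OF v_cond cond_L2_cnj[OF v_cond]]]) measurable
  with complex_cond_exp_abs_square[OF v] a
  have Tf: "AE x in M. ennreal ((cmod (weighted_cond_exp M F w u f x))\<^sup>2)
      = ennreal ((k x)\<^sup>2) * a x * a x * ennreal ((cmod (w x))\<^sup>2)"
  proof eventually_elim
    case (elim x)
    define c where "c = cond_sq M F (v n) x"
    have "(cmod (weighted_cond_exp M F w u f x))\<^sup>2 = (cmod (w x * (of_real (k x) * of_real c)))\<^sup>2"
      unfolding weighted_cond_exp_def uf elim(1,3) c_def ..
    also have "\<dots> = (cmod (w x))\<^sup>2 * ((k x)\<^sup>2 * c\<^sup>2)"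
      by (simp add: norm_mult power_mult_distrib)
    also have "\<dots> = (k x)\<^sup>2 * c * c * (cmod (w x))\<^sup>2"
      by (simp add: power2_eq_square)
    finally show ?case
      unfolding elim(2)[symmetric] c_def[symmetric] by (simp add: ennreal_mult c_def)
  qed
  have "(\<integral>\<^sup>+x. ennreal ((cmod (f x))\<^sup>2) \<partial>M) = (\<integral>\<^sup>+x. ennreal ((k x)\<^sup>2) * ennreal ((cmod (v n x))\<^sup>2) \<partial>M)"
    by (simp add: f_def norm_mult power_mult_distrib ennreal_mult)
  also have "\<dots> = (\<integral>\<^sup>+x. ennreal ((k x)\<^sup>2) * a x \<partial>M)"
    unfolding a_def by (rule nn_cond_exp_intg[symmetric]) measurable
  also have "ennreal (C\<^sup>2) * \<dots> = (\<integral>\<^sup>+x. ennreal ((k x)\<^sup>2) * (ennreal (C\<^sup>2) * a x) \<partial>M)"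
    by (subst nn_integral_cmult[symmetric]) (auto simp: ac_simps)
  finally have rhs: "ennreal (C\<^sup>2) * (\<integral>\<^sup>+x. ennreal ((cmod (f x))\<^sup>2) \<partial>M)
      = (\<integral>\<^sup>+x. ennreal ((k x)\<^sup>2) * (ennreal (C\<^sup>2) * a x) \<partial>M)" .
  have fin: "(\<integral>\<^sup>+x. ennreal ((k x)\<^sup>2) * (ennreal (C\<^sup>2) * a x) \<partial>M) \<noteq> \<infinity>"
    unfolding rhs[symmetric] nn_integral_eq_L2_norm[OF f] by (simp add: ennreal_mult_eq_top_iff)
  have "(\<integral>\<^sup>+x. ennreal ((k x)\<^sup>2) * a x * a x * b x \<partial>M)
      = (\<integral>\<^sup>+x. ennreal ((k x)\<^sup>2) * a x * a x * ennreal ((cmod (w x))\<^sup>2) \<partial>M)"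
    unfolding b_def by (rule nn_cond_exp_intg) measurable
  also have "\<dots> = (\<integral>\<^sup>+x. ennreal ((cmod (weighted_cond_exp M F w u f x))\<^sup>2) \<partial>M)"
    using Tf by (intro nn_integral_cong_AE) (auto elim: eventually_mono)
  also have "\<dots> = ennreal ((L2_norm M (weighted_cond_exp M F w u f))\<^sup>2)"
    by (rule nn_integral_eq_L2_norm[OF T[OF f]])
  also have "\<dots> \<le> ennreal ((C * L2_norm M f)\<^sup>2)"
    using C[OF f] by (intro ennreal_leI power_mono) (auto simp: L2_norm_def)
  also have "\<dots> = ennreal (C\<^sup>2) * (\<integral>\<^sup>+x. ennreal ((cmod (f x))\<^sup>2) \<partial>M)"
    by (simp add: nn_integral_eq_L2_norm[OF f] power_mult_distrib ennreal_mult)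
  also have "\<dots> = (\<integral>\<^sup>+x. ennreal ((k x)\<^sup>2) * (ennreal (C\<^sup>2) * a x) \<partial>M)"
    by (rule rhs)
  finally have le: "(\<integral>\<^sup>+x. ennreal ((k x)\<^sup>2) * a x * a x * b x \<partial>M)
      \<le> (\<integral>\<^sup>+x. ennreal ((k x)\<^sup>2) * (ennreal (C\<^sup>2) * a x) \<partial>M)" .
  have ge: "ennreal ((k x)\<^sup>2) * (ennreal (C\<^sup>2) * a x) \<le> ennreal ((k x)\<^sup>2) * a x * a x * b x" for x
  proof (cases "x \<in> N")
    case True
    then have "ennreal (C\<^sup>2) * a x \<le> b x * a x * a x" by (simp add: N_def less_imp_le)
    then have "ennreal ((k x)\<^sup>2) * (ennreal (C\<^sup>2) * a x) \<le> ennreal ((k x)\<^sup>2) * (b x * a x * a x)"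
      by (rule mult_left_mono) simp
    then show ?thesis by (simp only: ac_simps)
  qed (simp add: k2)
  have "AE x in M. ennreal ((k x)\<^sup>2) * a x * a x * b x \<le> ennreal ((k x)\<^sup>2) * (ennreal (C\<^sup>2) * a x)"
  proof (rule ccontr)
    assume "\<not> ?thesis"
    then have "(\<integral>\<^sup>+x. ennreal ((k x)\<^sup>2) * (ennreal (C\<^sup>2) * a x) \<partial>M)
        < (\<integral>\<^sup>+x. ennreal ((k x)\<^sup>2) * a x * a x * b x \<partial>M)"
      by (rule nn_integral_less[OF _ _ fin AE_I2[OF ge], rotated 2]) measurable
    with le show False by simp
  qed
  then show ?thesis
    using a AE_space unfolding a_def[symmetric] b_def[symmetric]
  proof eventually_elim
    case (elim x)
    have "x \<notin> N"
    proof
      assume x: "x \<in> N"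
      then have "ennreal (l x) * (a x * a x * b x) \<le> ennreal (l x) * (ennreal (C\<^sup>2) * a x)"
        using elim(1) by (simp add: k2 mult.assoc)
      then have "a x * a x * b x \<le> ennreal (C\<^sup>2) * a x"
        using l[of x] by (subst (asm) ennreal_mult_le_mult_iff) (auto simp: ennreal_eq_0_iff)
      with x show False by (auto simp: N_def ac_simps dest: leD)
    qed
    then have *: "a x * (b x * a x) \<le> a x * ennreal (C\<^sup>2)"
      using elim(3) by (simp add: N_def ac_simps not_less)
    show ?case
    proof (cases "a x = 0")
      case False
      moreover have "a x \<noteq> \<infinity>" using elim(2) by (metis ennreal_neq_top infinity_ennreal_def)
      ultimately show ?thesis using * by (simp add: ennreal_mult_le_mult_iff)
    qed simp
  qed
qed

text \<open>
  The bound for truncations passes to \<open>u\<close> by monotone convergence. The product is one of extended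
  numbers, so if one factor is infinite, the other one is \<open>0\<close>.
\<close>

lemma product_of_moments_bounded:
  assumes [measurable]: "u \<in> borel_measurable M" "w \<in> borel_measurable M"
    and T: "L2_bounded_operator M (weighted_cond_exp M F w u)"
  obtains K where "AE x in M. nn_cond_exp M F (\<lambda>y. ennreal ((cmod (w y))\<^sup>2)) x
    * nn_cond_exp M F (\<lambda>y. ennreal ((cmod (u y))\<^sup>2)) x \<le> ennreal K"
proof -
  obtain C where C: "\<And>f. f \<in> L2_space M \<Longrightarrow> L2_norm M (weighted_cond_exp M F w u f) \<le> C * L2_norm M f"
    using T unfolding L2_bounded_operator_def by blast
  let ?v = "\<lambda>n::nat. \<lambda>y. ennreal ((cmod (if cmod (u y) \<le> real n then u y else 0))\<^sup>2)"
  have "AE x in M. \<forall>n. nn_cond_exp M F (\<lambda>y. ennreal ((cmod (w y))\<^sup>2)) x * nn_cond_exp M F (?v n) x \<le> ennreal (C\<^sup>2)"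
    unfolding AE_all_countable
    using truncated_norm_bound[OF assms(1,2) _ C] T by (auto simp: L2_bounded_operator_def)
  moreover have "AE x in M. nn_cond_exp M F (\<lambda>y. SUP n. ?v n y) x = (SUP n. nn_cond_exp M F (?v n) x)"
    by (rule nn_cond_exp_monotone_convergence) (auto simp: incseq_def)
  ultimately have "AE x in M. nn_cond_exp M F (\<lambda>y. ennreal ((cmod (w y))\<^sup>2)) x
    * nn_cond_exp M F (\<lambda>y. ennreal ((cmod (u y))\<^sup>2)) x \<le> ennreal (C\<^sup>2)"
    unfolding SUP_truncated_square
    by eventually_elim (auto simp: SUP_mult_left_ennreal intro!: SUP_least)
  then show ?thesis by (rule that)
qed

lemma nn_cond_exp_indicator_square:
  assumes [measurable]: "A \<in> sets F" "g \<in> borel_measurable M"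
  shows "AE x in M. nn_cond_exp M F (\<lambda>y. ennreal ((cmod (indicator A y * g y))\<^sup>2)) x
    = indicator A x * nn_cond_exp M F (\<lambda>y. ennreal ((cmod (g y))\<^sup>2)) x"
proof -
  have "(\<lambda>y. ennreal ((cmod (indicator A y * g y))\<^sup>2)) = (\<lambda>y. indicator A y * ennreal ((cmod (g y))\<^sup>2))"
    by (auto simp: indicator_def fun_eq_iff)
  then show ?thesis using nn_cond_exp_prod[of "indicator A" "\<lambda>y. ennreal ((cmod (g y))\<^sup>2)"]
    by (auto simp: eq_commute)
qed

end

section \<open>Centeredness and equality in the Cauchy-Schwarz inequality\<close>

theorem theorem2p5:
  fixes M F :: "'a measure" and u w :: "'a \<Rightarrow> complex"
  assumes "complete_measure M"
    and "sigma_finite_measure M"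
    and "sigma_finite_subalgebra M F"
    and "u \<in> cond_exp_domain M F"
    and "w \<in> cond_exp_domain M F"
    and "L2_bounded_operator M (weighted_cond_exp M F w u)"
  shows "(L2_centered M (weighted_cond_exp M F w u) \<longrightarrow>
      (AE x in M.
        complex_cond_exp M F (\<lambda>y. u y * w y) x * complex_cond_exp M F w x * complex_cond_exp M F u x \<noteq> 0 \<longrightarrow>
        ennreal ((cmod (complex_cond_exp M F (\<lambda>y. u y * w y) x))\<^sup>2) =
          nn_cond_exp M F (\<lambda>y. ennreal ((cmod (u y))\<^sup>2)) x * nn_cond_exp M F (\<lambda>y. ennreal ((cmod (w y))\<^sup>2)) x)) \<and>
    ((AE x in M.
        ennreal ((cmod (complex_cond_exp M F (\<lambda>y. u y * w y) x))\<^sup>2) =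
          nn_cond_exp M F (\<lambda>y. ennreal ((cmod (u y))\<^sup>2)) x * nn_cond_exp M F (\<lambda>y. ennreal ((cmod (w y))\<^sup>2)) x) \<longrightarrow>
      L2_centered M (weighted_cond_exp M F w u))"
proof -
  interpret sigma_finite_subalgebra M F by (rule assms(3))
  have [measurable]: "u \<in> borel_measurable M" "w \<in> borel_measurable M" using assms(4,5) by measurable
  let ?E = "complex_cond_exp M F"
  define a where "a = nn_cond_exp M F (\<lambda>y. ennreal ((cmod (u y))\<^sup>2))"
  define b where "b = nn_cond_exp M F (\<lambda>y. ennreal ((cmod (w y))\<^sup>2))"
  have [measurable]: "a \<in> borel_measurable F" "b \<in> borel_measurable F" unfolding a_def b_def by measurable
  obtain K where ab: "AE x in M. b x * a x \<le> ennreal K"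
    using product_of_moments_bounded[of u w] assms(6) unfolding a_def b_def by auto
  \<comment> \<open>Off \<open>P\<close> one of the moments is infinite, hence the other one, and the weight that belongs to it, is \<open>0\<close>.\<close>
  define P where "P = {x \<in> space M. a x < \<infinity> \<and> b x < \<infinity>}"
  define Z where "Z = {x \<in> space M. a x = 0}"
  have F: "space F = space M" "sets F \<subseteq> sets M" using subalg by (auto simp: subalgebra_def)
  have "P = {x \<in> space F. a x < \<infinity> \<and> b x < \<infinity>}" "Z = {x \<in> space F. a x = 0}"
    by (simp_all add: P_def Z_def F)
  then have PF [measurable]: "P \<in> sets F" and ZF: "Z \<in> sets F" by simp_all
  then have PM [measurable]: "P \<in> sets M" using F by blast
  have u0: "AE x in M. a x = 0 \<longrightarrow> u x = 0"
    using eq_0_where_nn_cond_exp_eq_0[of "\<lambda>y. ennreal ((cmod (u y))\<^sup>2)"]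
    unfolding a_def by (simp add: ennreal_eq_0_iff)
  have w0: "AE x in M. b x = 0 \<longrightarrow> w x = 0"
    using eq_0_where_nn_cond_exp_eq_0[of "\<lambda>y. ennreal ((cmod (w y))\<^sup>2)"]
    unfolding b_def by (simp add: ennreal_eq_0_iff)
  have off: "AE x in M. x \<notin> P \<longrightarrow> a x = 0 \<or> b x = 0"
    using ab AE_space
    by eventually_elim (auto simp: P_def not_less top_unique ennreal_mult_top ennreal_top_mult split: if_splits)
  define u1 where "u1 = (\<lambda>y. indicator P y * u y)"
  define w1 where "w1 = (\<lambda>y. indicator P y * w y)"
  have [measurable]: "u1 \<in> borel_measurable M" "w1 \<in> borel_measurable M"
    unfolding u1_def w1_def by measurable
  have a1: "AE x in M. nn_cond_exp M F (\<lambda>y. ennreal ((cmod (u1 y))\<^sup>2)) x = indicator P x * a x"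
    and b1: "AE x in M. nn_cond_exp M F (\<lambda>y. ennreal ((cmod (w1 y))\<^sup>2)) x = indicator P x * b x"
    unfolding u1_def w1_def a_def b_def by (rule nn_cond_exp_indicator_square; measurable)+
  have u1: "u1 \<in> cond_L2 M F" and w1: "w1 \<in> cond_L2 M F"
    unfolding cond_L2_def
    by (auto intro: eventually_mono[OF a1] eventually_mono[OF b1] simp: P_def indicator_def)
  have alpha: "AE x in M. ennreal (cond_sq M F u1 x) = indicator P x * a x"
    and beta: "AE x in M. ennreal (cond_sq M F w1 x) = indicator P x * b x"
    using ennreal_cond_sq[OF u1] ennreal_cond_sq[OF w1] a1 b1 by auto
  have bound: "AE x in M. cond_sq M F w1 x * cond_sq M F u1 x \<le> max 0 K"
    using alpha beta ab
  proof eventually_elim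
    case (elim x)
    have "ennreal (cond_sq M F w1 x * cond_sq M F u1 x) \<le> ennreal (max 0 K)"
      using elim by (auto simp: ennreal_mult indicator_def max_def ennreal_neg split: if_splits)
    then show ?case by (subst (asm) ennreal_le_iff) auto
  qed
  have restrict: "AE x in M. ?E (\<lambda>y. u1 y * f y) x = indicator P x * ?E (\<lambda>y. u y * f y) x"
    if [measurable]: "f \<in> borel_measurable M" for f
    using complex_cond_exp_indicator_mult[OF PF, of "\<lambda>y. u y * f y"] by (simp add: u1_def mult.assoc)
  have T_eq: "AE x in M. weighted_cond_exp M F w u f x = weighted_cond_exp M F w1 u1 f x"
    if "f \<in> L2_space M" for f
  proof -
    have [measurable]: "f \<in> borel_measurable M" using that by measurable
    \<comment> \<open>Where \<open>a = 0\<close> and \<open>b = \<infinity>\<close>, the operator vanishes because of \<open>E(u f) = 0\<close>, not because of \<open>w\<close>.\<close>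
    have "AE x in M. x \<in> Z \<longrightarrow> ?E (\<lambda>y. u y * f y) x = 0"
      using u0 by (intro complex_cond_exp_eq_0_on ZF) (auto simp: Z_def elim!: eventually_mono)
    moreover have "AE x in M. ?E (\<lambda>y. u1 y * f y) x = indicator P x * ?E (\<lambda>y. u y * f y) x"
      by (rule restrict) measurable
    ultimately show ?thesis using off w0 AE_space
      by eventually_elim (auto simp: weighted_cond_exp_def w1_def Z_def indicator_def)
  qed
  interpret W: weighted_conditional_operator M F w1 u1 "weighted_cond_exp M F w u" "max 0 K"
    by unfold_locales (use w1 u1 bound assms(6) T_eq in auto)
  have "(\<lambda>y. u1 y * w1 y) = (\<lambda>y. indicator P y * (u y * w y))"
    by (auto simp: u1_def w1_def indicator_def fun_eq_iff)
  then have gamma: "AE x in M. ?E (\<lambda>y. u1 y * w1 y) x = indicator P x * ?E (\<lambda>y. u y * w y) x"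
    using complex_cond_exp_indicator_mult[OF PF, of "\<lambda>y. u y * w y"] by simp
  have PF': "space M - P \<in> sets F" using PF F by (metis sets.compl_sets)
  have "AE x in M. x \<in> space M - P \<longrightarrow> u x * w x = 0"
    using off u0 w0 by eventually_elim auto
  then have "AE x in M. x \<in> space M - P \<longrightarrow> ?E (\<lambda>y. u y * w y) x = 0"
    by (rule complex_cond_exp_eq_0_on[OF PF', rotated]) measurable
  with gamma AE_space have cross: "AE x in M. (x \<in> P \<and> ?E (\<lambda>y. u1 y * w1 y) x = ?E (\<lambda>y. u y * w y) x)
      \<or> (x \<notin> P \<and> ?E (\<lambda>y. u1 y * w1 y) x = 0 \<and> ?E (\<lambda>y. u y * w y) x = 0)"
    by eventually_elim (auto simp: indicator_def)
  show ?thesis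
    unfolding a_def[symmetric] b_def[symmetric]
  proof (intro conjI impI)
    assume "L2_centered M (weighted_cond_exp M F w u)"
    from W.equality_if_centered[OF this] cross alpha beta
    show "AE x in M. ?E (\<lambda>y. u y * w y) x * ?E w x * ?E u x \<noteq> 0 \<longrightarrow>
        ennreal ((cmod (?E (\<lambda>y. u y * w y) x))\<^sup>2) = a x * b x"
      by eventually_elim (auto simp: ennreal_mult)
  next
    assume "AE x in M. ennreal ((cmod (?E (\<lambda>y. u y * w y) x))\<^sup>2) = a x * b x"
    then have "AE x in M. (cmod (?E (\<lambda>y. u1 y * w1 y) x))\<^sup>2 = cond_sq M F u1 x * cond_sq M F w1 x"
      using cross alpha beta
    proof eventually_elim
      case (elim x)
      have "ennreal ((cmod (?E (\<lambda>y. u1 y * w1 y) x))\<^sup>2) = ennreal (cond_sq M F u1 x * cond_sq M F w1 x)"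
        using elim by (auto simp: ennreal_mult)
      then show ?case by (subst (asm) ennreal_inj) auto
    qed
    then show "L2_centered M (weighted_cond_exp M F w u)" by (rule W.centered_if_equality)
  qed
qed

end
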